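(* The maximal angle between two (nonzero) copositive matrices of order $3$ is equal to $\frac{3\pi}{4}$; that is, $\theta_3=\frac{3\pi}{4}$, where $$\theta_3=\max_{A,B\in\mathcal{C}_3,\ \|A\|=\|B\|=1}\arccos\langle A,B\rangle .$$ Moreover, up to simultaneous row and column permutation, multiplication of each matrix by a positive scalar, and exchange of the roles of the two matrices, this value is attained exactly by the pairs $(A,B)$ of the form $$A=\begin{bmatrix}\frac12 & -\sqrt{a_{22}/2} & -\sqrt{a_{33}/2}\\ -\sqrt{a_{22}/2} & a_{22} & \sqrt{a_{22}a_{33}}\\ -\sqrt{a_{33}/2} & \sqrt{a_{22}a_{33}} & a_{33}\end{bmatrix},\qquad B=\begin{bmatrix}0&\sqrt{a_{22}}&\sqrt{a_{33}}\\ \sqrt{a_{22}}&0&0\\ \sqrt{a_{33}}&0&0\end{bmatrix},$$ with $a_{22}\ge 0$, $a_{33}\ge 0$ and $a_{22}+a_{33}=\frac12$.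
   Context: A real symmetric $n\times n$ matrix $A$ is copositive if $x^TAx\ge 0$ for every entrywise nonnegative $x\in\mathbb{R}^n$; $\mathcal{C}_n$ is the set of such matrices. The inner product on real symmetric matrices is $\langle A,B\rangle=\mathrm{Tr}(AB)$, with norm $\|A\|=\sqrt{\mathrm{Tr}(A^2)}$. The angle between nonzero symmetric matrices $A,B$ is $\arccos\left(\frac{\langle A,B\rangle}{\|A\|\,\|B\|}\right)\in[0,\pi]$. "Up to simultaneous row and column permutation and multiplication by a positive scalar" means that $(A,B)$ is identified with $(c\,P^TAP,\ d\,P^TBP)$ for any permutation matrix $P$ (the same for both matrices) and any $c,d>0$. *)

theory Defs
  imports "HOL-Analysis.Analysis"
begin

definition symmetric_matrix :: "real^'n^'n \<Rightarrow> bool" where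
  "symmetric_matrix A \<longleftrightarrow> transpose A = A"

definition copositive :: "(real^'n^'n) set" where
  "copositive = {A. symmetric_matrix A \<and> (\<forall>x::real^'n. (\<forall>i. 0 \<le> x $ i) \<longrightarrow> 0 \<le> x \<bullet> (A *v x))}"

definition trace_inner :: "real^'n^'n \<Rightarrow> real^'n^'n \<Rightarrow> real" where
  "trace_inner A B = trace (A ** B)"

definition frobenius_norm :: "real^'n^'n \<Rightarrow> real" where
  "frobenius_norm A = sqrt (trace_inner A A)"

definition matrix_angle :: "real^'n^'n \<Rightarrow> real^'n^'n \<Rightarrow> real" where
  "matrix_angle A B = arccos (trace_inner A B / (frobenius_norm A * frobenius_norm B))"

definition unit_copositive_angles :: "'n::finite itself \<Rightarrow> real set" where
  "unit_copositive_angles _ =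
     {arccos (trace_inner A B) | A B :: real^'n^'n.
        A \<in> copositive \<and> B \<in> copositive \<and> frobenius_norm A = 1 \<and> frobenius_norm B = 1}"

text \<open>
  \<^const>\<open>Greatest\<close> is only meaningful if the maximum is attained; a statement about
  \<open>max_copositive_angle\<close> should therefore also assert membership in
  \<^const>\<open>unit_copositive_angles\<close>.
\<close>

definition max_copositive_angle :: "'n::finite itself \<Rightarrow> real" where
  "max_copositive_angle T = (GREATEST t. t \<in> unit_copositive_angles T)"

definition permutation_matrix :: "real^'n^'n \<Rightarrow> bool" where
  "permutation_matrix P \<longleftrightarrow>
     (\<exists>p. p permutes UNIV \<and> P = (\<chi> i j. if j = p i then 1 else 0))"

text \<open>
  The same permutation matrix acts on both components, the scaling factors are independent.
\<close>

definition perm_scale_equiv ::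
    "(real^'n^'n) \<times> (real^'n^'n) \<Rightarrow> (real^'n^'n) \<times> (real^'n^'n) \<Rightarrow> bool" where
  "perm_scale_equiv = (\<lambda>(A, B) (A', B').
     \<exists>P c d. permutation_matrix P \<and> c > 0 \<and> d > 0 \<and>
       A' = c *\<^sub>R (transpose P ** A ** P) \<and> B' = d *\<^sub>R (transpose P ** B ** P))"

definition extremal_A :: "real \<Rightarrow> real \<Rightarrow> real^3^3" where
  "extremal_A a22 a33 = vector
     [vector [1/2, - sqrt (a22/2), - sqrt (a33/2)],
      vector [- sqrt (a22/2), a22, sqrt (a22 * a33)],
      vector [- sqrt (a33/2), sqrt (a22 * a33), a33]]"

definition extremal_B :: "real \<Rightarrow> real \<Rightarrow> real^3^3" where
  "extremal_B a22 a33 = vector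
     [vector [0, sqrt a22, sqrt a33],
      vector [sqrt a22, 0, 0],
      vector [sqrt a33, 0, 0]]"

end

theory Submission
  imports Defs
begin

text \<open>
  An angle is at most \<open>3\<pi>/4\<close> iff \<open>2 \<langle>A,B\<rangle>\<^sup>2 \<le> \<parallel>A\<parallel>\<^sup>2 \<parallel>B\<parallel>\<^sup>2\<close> or \<open>\<langle>A,B\<rangle> \<ge> 0\<close>. Negative contributions
  to \<open>\<langle>A,B\<rangle>\<close> come only from off-diagonal positions where the entries have opposite signs.
  If it is always the same matrix, say \<open>A\<close>, that is negative there, then Cauchy-Schwarz reduces
  the bound to the fact that the negative entries of \<open>A\<close> carry at most half of \<open>\<parallel>A\<parallel>\<^sup>2\<close>, and the
  equality cases of both inequalities give the extremal pairs. If both signs occur, weighted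
  forms of Cauchy-Schwarz give a strict inequality.
\<close>

subsection \<open>Entries of symmetric and copositive matrices of order three\<close>

text \<open>The factor 2 is 1 / cos^2 (3 pi / 4), and it arises from weights. Off-diagonal entries
  count twice in the squared norm. Where an entry is negative, copositivity also forces the
  diagonal, together with the entry outside the row when two negative ones share it, to be equally
  heavy, so a negative entry weighs 4; a positive entry forces nothing and weighs 2. A place where
  the signs disagree pairs weight 4 with weight 2, against the factor 2^2 from the doubled inner
  product: 8 / 4 = 2.

  The obstacle is disagreement in both directions. Each matrix then has entries of both weights, and
  separate estimates for the two directions could add up to more than the bound, so the weights have
  to enter one common Cauchy-Schwarz inequality.

  In order three any two off-diagonal places share an index. Up to the order of the indices few sign
  patterns remain, and stating everything for arbitrary distinct i, j, k makes each symmetry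
  argument a mere instantiation.\<close>

lemma UNIV_3_distinct:
  assumes "distinct [i, j, k :: 3]"
  shows "UNIV = {i, j, k}"
proof (rule sym, rule card_subset_eq)
  have "card {i, j, k} = 3" using assms by simp
  then show "card {i, j, k} = card (UNIV :: 3 set)" by simp
qed simp_all

lemma sum_UNIV_3_distinct:
  fixes f :: "3 \<Rightarrow> 'a::comm_monoid_add"
  assumes "distinct [i, j, k]"
  shows "sum f UNIV = f i + (f j + f k)"
proof -
  have "sum f UNIV = sum f {i, j, k}" by (simp only: UNIV_3_distinct[OF assms])
  then show ?thesis using assms by simp
qed

lemma symmetric_matrix_nth:
  assumes "symmetric_matrix A"
  shows "A $ i $ j = A $ j $ i"
proof -
  have "A $ i $ j = transpose A $ i $ j" using assms by (simp add: symmetric_matrix_def)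
  then show ?thesis by (simp add: transpose_def)
qed

lemma trace_inner_sum: "trace_inner A B = (\<Sum>i\<in>UNIV. \<Sum>j\<in>UNIV. A $ i $ j * B $ j $ i)"
  by (simp add: trace_inner_def trace_def matrix_matrix_mult_def)

lemma trace_inner_commute: "trace_inner A B = trace_inner B A"
  unfolding trace_inner_def by (rule trace_mul_sym)

lemma trace_inner_3:
  assumes "distinct [i, j, k :: 3]" and "symmetric_matrix A" and "symmetric_matrix B"
  shows "trace_inner A B = A $ i $ i * B $ i $ i + A $ j $ j * B $ j $ j + A $ k $ k * B $ k $ k
    + 2 * (A $ i $ j * B $ i $ j + A $ i $ k * B $ i $ k + A $ j $ k * B $ j $ k)"
  using symmetric_matrix_nth[OF assms(2), of j i] symmetric_matrix_nth[OF assms(2), of k i]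
    symmetric_matrix_nth[OF assms(2), of k j] symmetric_matrix_nth[OF assms(3), of j i]
    symmetric_matrix_nth[OF assms(3), of k i] symmetric_matrix_nth[OF assms(3), of k j]
  by (simp add: trace_inner_sum sum_UNIV_3_distinct[OF assms(1)] algebra_simps)

lemma trace_inner_self_3:
  assumes "distinct [i, j, k :: 3]" and "symmetric_matrix A"
  shows "trace_inner A A = (A $ i $ i)\<^sup>2 + (A $ j $ j)\<^sup>2 + (A $ k $ k)\<^sup>2
    + 2 * ((A $ i $ j)\<^sup>2 + (A $ i $ k)\<^sup>2 + (A $ j $ k)\<^sup>2)"
  using trace_inner_3[OF assms(1,2,2)] by (simp add: power2_eq_square)

lemma quadratic_form_3:
  fixes A :: "real^3^3"
  assumes "distinct [i, j, k]" and "symmetric_matrix A"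
  shows "v \<bullet> (A *v v) = A $ i $ i * (v $ i)\<^sup>2 + A $ j $ j * (v $ j)\<^sup>2 + A $ k $ k * (v $ k)\<^sup>2
    + 2 * (A $ i $ j * v $ i * v $ j + A $ i $ k * v $ i * v $ k + A $ j $ k * v $ j * v $ k)"
  using symmetric_matrix_nth[OF assms(2), of j i] symmetric_matrix_nth[OF assms(2), of k i]
    symmetric_matrix_nth[OF assms(2), of k j]
  by (simp add: inner_vec_def matrix_vector_mult_def sum_UNIV_3_distinct[OF assms(1)]
      algebra_simps power2_eq_square)

lemma copositive_symmetric: "A \<in> copositive \<Longrightarrow> symmetric_matrix A"
  by (simp add: copositive_def)

lemma copositive_form_nonneg:
  fixes A :: "real^3^3"
  assumes "A \<in> copositive" and "distinct [i, j, k]" and "0 \<le> x" "0 \<le> y" "0 \<le> z"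
  shows "0 \<le> A $ i $ i * x\<^sup>2 + A $ j $ j * y\<^sup>2 + A $ k $ k * z\<^sup>2
    + 2 * (A $ i $ j * x * y + A $ i $ k * x * z + A $ j $ k * y * z)"
proof -
  define v :: "real^3" where "v = (\<chi> l. if l = i then x else if l = j then y else z)"
  have "v $ i = x" "v $ j = y" "v $ k = z"
    using assms(2) by (auto simp: v_def)
  moreover have "0 \<le> v \<bullet> (A *v v)"
    using assms by (auto simp: copositive_def v_def)
  ultimately show ?thesis
    by (simp add: quadratic_form_3[OF assms(2) copositive_symmetric[OF assms(1)]])
qed

text \<open>Since the mixed term is nonpositive, the critical test vector \<open>(w, s)\<close> lies
  in the nonnegative quadrant, and the form takes the value \<open>s * (s * t - w^2)\<close>
  there.\<close>

lemma binary_form_nonneg: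
  fixes s t w :: real
  assumes form: "\<And>y z. 0 \<le> y \<Longrightarrow> 0 \<le> z \<Longrightarrow> 0 \<le> s * y\<^sup>2 + t * z\<^sup>2 - 2 * w * y * z"
    and "0 \<le> w"
  shows "0 \<le> s" and "0 \<le> t" and "w\<^sup>2 \<le> s * t"
proof -
  show s: "0 \<le> s" using form[of 1 0] by simp
  show t: "0 \<le> t" using form[of 0 1] by simp
  show "w\<^sup>2 \<le> s * t"
  proof (cases "s = 0")
    case True
    have "w = 0"
    proof (rule ccontr)
      assume "w \<noteq> 0"
      then have "0 < w" using \<open>0 \<le> w\<close> by simp
      \<comment> \<open>With z = 1 this y gives the form the value t - (t + 1) = -1.\<close>
      then show False
        using form[of "(t + 1) / (2 * w)" 1] t True by (simp add: field_simps)
    qed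
    then show ?thesis using True by simp
  next
    case False
    have "0 \<le> s * (s * t - w\<^sup>2)"
      using form[of w s] s \<open>0 \<le> w\<close> by (simp add: algebra_simps power2_eq_square)
    then show ?thesis using False s by (simp add: zero_le_mult_iff)
  qed
qed

lemma third_index:
  fixes i j :: 3
  assumes "i \<noteq> j"
  obtains k where "distinct [i, j, k]"
proof -
  have "{i, j} \<noteq> UNIV"
  proof
    assume "{i, j} = UNIV"
    then have "card {i, j} = card (UNIV :: 3 set)" by simp
    then show False using assms by simp
  qed
  then show ?thesis using that assms by fastforce
qed

lemma copositive_diag_nonneg:
  fixes A :: "real^3^3"
  assumes "A \<in> copositive"
  shows "0 \<le> A $ i $ i"
proof -
  obtain j :: 3 where "i \<noteq> j" by (metis (full_types) one_neq_zero)
  then obtain k where d: "distinct [i, j, k]" using third_index by blast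
  show ?thesis using copositive_form_nonneg[OF assms d, of 1 0 0] by simp
qed

text \<open>Restrict the form to vectors with vanishing k-th coordinate. The sign assumption is
  essential: a positive entry may stand between zero diagonal entries, as in
  \<open>extremal_B\<close>.\<close>

lemma copositive_minor:
  fixes A :: "real^3^3"
  assumes A: "A \<in> copositive" and "i \<noteq> j" and neg: "A $ i $ j \<le> 0"
  shows "(A $ i $ j)\<^sup>2 \<le> A $ i $ i * A $ j $ j"
proof -
  obtain k where d: "distinct [i, j, k]" using \<open>i \<noteq> j\<close> third_index by blast
  have "(- A $ i $ j)\<^sup>2 \<le> A $ i $ i * A $ j $ j"
    by (rule binary_form_nonneg(3))
      (use copositive_form_nonneg[OF A d, of _ _ 0] neg in \<open>auto simp: algebra_simps\<close>)
  then show ?thesis by simp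
qed

subsection \<open>The weight of the negative entries\<close>

definition neg_part :: "real \<Rightarrow> real" where
  "neg_part x = max 0 (- x)"

lemma neg_part_nonneg [simp]: "0 \<le> neg_part x"
  by (simp add: neg_part_def)

lemma neg_part_sq_le: "(neg_part x)\<^sup>2 \<le> x\<^sup>2"
  by (auto simp: neg_part_def max_def)

text \<open>Allows a test vector built from negative parts to be evaluated without a case split on
  the signs of the entries.\<close>

lemma mult_neg_part: "x * neg_part x = - (neg_part x)\<^sup>2"
  by (auto simp: neg_part_def max_def power2_eq_square)

text \<open>
  Up to the order of the indices and positive factors, this describes \<open>extremal_A\<close> and \<open>extremal_B\<close>:
  \<open>A\<close> is a rank one matrix \<open>vv\<^sup>T\<close> with \<open>v\<^sub>i\<^sup>2 = v\<^sub>j\<^sup>2 + v\<^sub>k\<^sup>2\<close>, and \<open>B\<close> is a multiple of its negative part.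
\<close>

definition extremal_pair :: "real^3^3 \<Rightarrow> real^3^3 \<Rightarrow> 3 \<Rightarrow> 3 \<Rightarrow> 3 \<Rightarrow> bool" where
  "extremal_pair A B i j k \<longleftrightarrow>
     distinct [i, j, k] \<and> symmetric_matrix A \<and> symmetric_matrix B \<and>
     0 < A $ i $ i \<and> A $ i $ j \<le> 0 \<and> A $ i $ k \<le> 0 \<and>
     (A $ i $ j)\<^sup>2 + (A $ i $ k)\<^sup>2 = (A $ i $ i)\<^sup>2 \<and>
     A $ i $ i * A $ j $ j = (A $ i $ j)\<^sup>2 \<and> A $ i $ i * A $ k $ k = (A $ i $ k)\<^sup>2 \<and>
     A $ i $ i * A $ j $ k = A $ i $ j * A $ i $ k \<and>
     B $ i $ i = 0 \<and> B $ j $ j = 0 \<and> B $ k $ k = 0 \<and> B $ j $ k = 0 \<and>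
     (\<exists>d>0. B $ i $ j = - d * A $ i $ j \<and> B $ i $ k = - d * A $ i $ k)"

text \<open>The inequality comes from testing copositivity on \<open>(t, p, q)\<close> and optimising over \<open>t\<close>.\<close>

lemma border_bound:
  fixes a b c p q r :: real
  assumes form: "\<And>t z. 0 \<le> t \<Longrightarrow> 0 \<le> z \<Longrightarrow>
      0 \<le> a * t\<^sup>2 + (b * p\<^sup>2 + 2 * r * p * q + c * q\<^sup>2) * z\<^sup>2 - 2 * (p\<^sup>2 + q\<^sup>2) * t * z"
    and pos: "0 < p\<^sup>2 + q\<^sup>2"
  shows "2 * (p\<^sup>2 + q\<^sup>2) \<le> a\<^sup>2 + b\<^sup>2 + c\<^sup>2 + 2 * r\<^sup>2"
    and "2 * (p\<^sup>2 + q\<^sup>2) = a\<^sup>2 + b\<^sup>2 + c\<^sup>2 + 2 * r\<^sup>2 \<Longrightarrow>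
      0 < a \<and> p\<^sup>2 + q\<^sup>2 = a\<^sup>2 \<and> a * b = p\<^sup>2 \<and> a * c = q\<^sup>2 \<and> a * r = p * q"
proof -
  define g h m where "g = p\<^sup>2 + q\<^sup>2" and "h = b * p\<^sup>2 + 2 * r * p * q + c * q\<^sup>2"
    and "m = b\<^sup>2 + c\<^sup>2 + 2 * r\<^sup>2"
  have "0 < g" using pos by (simp add: g_def)
  have a: "0 \<le> a" and h: "0 \<le> h" and gh: "g\<^sup>2 \<le> a * h"
    using binary_form_nonneg[of a h g] form \<open>0 < g\<close> by (auto simp: g_def h_def)
  \<comment> \<open>Lagrange's identity for the block M with rows (b, r) and (r, c) and the rank one
    matrix W of the vector (p, q): h is their inner product, m and g^2 are their squared norms. The
    chain behind the bound is g^2 \<le> a h \<le> a g sqrt m, hence g \<le> a sqrt m \<le> (a^2 + m)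
    / 2; it is carried out with squares to avoid roots.\<close>
  have lagrange: "m * g\<^sup>2 - h\<^sup>2 =
      (b * q\<^sup>2 - c * p\<^sup>2)\<^sup>2 + 2 * (b * p * q - r * p\<^sup>2)\<^sup>2 + 2 * (r * q\<^sup>2 - c * p * q)\<^sup>2"
    by (simp add: g_def h_def m_def power2_eq_square algebra_simps)
  have "0 \<le> m * g\<^sup>2 - h\<^sup>2" unfolding lagrange by (intro add_nonneg_nonneg) auto
  then have hm: "h\<^sup>2 \<le> m * g\<^sup>2" by simp
  have gh4: "(g\<^sup>2)\<^sup>2 \<le> a\<^sup>2 * h\<^sup>2"
    using power_mono[OF gh, of 2] by (simp add: power_mult_distrib)
  have "a\<^sup>2 * h\<^sup>2 \<le> a\<^sup>2 * (m * g\<^sup>2)" by (rule mult_left_mono[OF hm]) simp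
  with gh4 have "g\<^sup>2 * g\<^sup>2 \<le> (a\<^sup>2 * m) * g\<^sup>2" by (simp add: power2_eq_square algebra_simps)
  then have gm: "g\<^sup>2 \<le> a\<^sup>2 * m"
    by (rule mult_right_le_imp_le) (use \<open>0 < g\<close> in simp)
  have amgm: "(a\<^sup>2 + m)\<^sup>2 - 4 * (a\<^sup>2 * m) = (a\<^sup>2 - m)\<^sup>2"
    by (simp add: power2_eq_square algebra_simps)
  have m0: "0 \<le> m" by (simp add: m_def)
  have "0 \<le> (a\<^sup>2 + m)\<^sup>2 - 4 * (a\<^sup>2 * m)" unfolding amgm by simp
  moreover have "4 * g\<^sup>2 \<le> 4 * (a\<^sup>2 * m)" using gm by simp
  ultimately have "(2 * g)\<^sup>2 \<le> (a\<^sup>2 + m)\<^sup>2" by (simp add: power_mult_distrib)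
  then have le: "2 * g \<le> a\<^sup>2 + m"
    by (rule power2_le_imp_le) (simp add: m0)
  then show "2 * (p\<^sup>2 + q\<^sup>2) \<le> a\<^sup>2 + b\<^sup>2 + c\<^sup>2 + 2 * r\<^sup>2" by (simp add: g_def m_def)
  assume "2 * (p\<^sup>2 + q\<^sup>2) = a\<^sup>2 + b\<^sup>2 + c\<^sup>2 + 2 * r\<^sup>2"
  then have eq: "2 * g = a\<^sup>2 + m" by (simp add: g_def m_def)
  have "4 * g\<^sup>2 = (a\<^sup>2 + m)\<^sup>2" unfolding eq[symmetric] by (simp add: power_mult_distrib)
  moreover have "4 * g\<^sup>2 \<le> 4 * (a\<^sup>2 * m)" using gm by simp
  ultimately have "(a\<^sup>2 - m)\<^sup>2 \<le> 0" unfolding amgm[symmetric] by simp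
  then have m: "m = a\<^sup>2" by simp
  then have ga: "g = a\<^sup>2" using eq by simp
  then have apos: "0 < a" using \<open>0 < g\<close> a by (cases "a = 0") auto
  have ha: "h = a * g"
  proof (rule antisym)
    show "h \<le> a * g"
      by (rule power2_le_imp_le) (use hm m a \<open>0 < g\<close> in \<open>auto simp: power_mult_distrib\<close>)
    have "g * (a * a) \<le> a * h" using gh ga by (simp add: power2_eq_square)
    then have "a * (a * g) \<le> a * h" by (simp add: algebra_simps)
    then show "a * g \<le> h" using apos by simp
  qed
  then have "m * g\<^sup>2 - h\<^sup>2 = 0" by (simp add: m power_mult_distrib)
  \<comment> \<open>Equality in Cauchy-Schwarz makes M a multiple of W. The multiple is h / g^2 = 1
    / a, which the remaining steps extract without dividing by p or q, as one of them may
    vanish.\<close>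
  then have "b * q\<^sup>2 - c * p\<^sup>2 = 0 \<and> b * p * q - r * p\<^sup>2 = 0 \<and> r * q\<^sup>2 - c * p * q = 0"
    unfolding lagrange
    by (smt (verit) zero_le_power2 zero_eq_power2)
  then have e: "b * q\<^sup>2 = c * p\<^sup>2" "b * p * q = r * p\<^sup>2" "r * q\<^sup>2 = c * p * q" by auto
  have "p\<^sup>2 * h - b * g\<^sup>2 = 2 * p * q * (r * p\<^sup>2 - b * p * q) + q\<^sup>2 * (c * p\<^sup>2 - b * q\<^sup>2)"
    by (simp add: h_def g_def power2_eq_square algebra_simps)
  moreover have "q\<^sup>2 * h - c * g\<^sup>2 = p\<^sup>2 * (b * q\<^sup>2 - c * p\<^sup>2) + 2 * p * q * (r * q\<^sup>2 - c * p * q)"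
    by (simp add: h_def g_def power2_eq_square algebra_simps)
  moreover have "p * q * h - r * g\<^sup>2 = p\<^sup>2 * (b * p * q - r * p\<^sup>2) - q\<^sup>2 * (r * q\<^sup>2 - c * p * q)"
    by (simp add: h_def g_def power2_eq_square algebra_simps)
  ultimately have "p\<^sup>2 * h = b * g\<^sup>2" "q\<^sup>2 * h = c * g\<^sup>2" "p * q * h = r * g\<^sup>2"
    by (simp_all add: e)
  then have "(p\<^sup>2 * a) * g = (b * g) * g" "(q\<^sup>2 * a) * g = (c * g) * g"
    "(p * q * a) * g = (r * g) * g"
    by (simp_all add: ha power2_eq_square algebra_simps)
  then have "p\<^sup>2 * a = (a * b) * a" "q\<^sup>2 * a = (a * c) * a" "p * q * a = (a * r) * a"
    using \<open>0 < g\<close> by (simp_all add: ga power2_eq_square algebra_simps)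
  then show "0 < a \<and> p\<^sup>2 + q\<^sup>2 = a\<^sup>2 \<and> a * b = p\<^sup>2 \<and> a * c = q\<^sup>2 \<and> a * r = p * q"
    using apos ga g_def by auto
qed

text \<open>With p, q the negative parts in row i, the vector (t, p z, q z) turns the row terms into
  -p^2 t z and -q^2 t z whatever the signs there, which is the form \<open>border_bound\<close> asks
  for. Positive entries of the row only enlarge the norm, so equality excludes them. The positivity
  premise of the second part rules out the zero matrix.\<close>

lemma neg_part_bound:
  fixes A :: "real^3^3"
  assumes A: "A \<in> copositive" and d: "distinct [i, j, k]" and jk: "0 \<le> A $ j $ k"
  shows "4 * ((neg_part (A $ i $ j))\<^sup>2 + (neg_part (A $ i $ k))\<^sup>2) \<le> trace_inner A A"
    and "4 * ((neg_part (A $ i $ j))\<^sup>2 + (neg_part (A $ i $ k))\<^sup>2) = trace_inner A A \<Longrightarrow>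
      0 < (neg_part (A $ i $ j))\<^sup>2 + (neg_part (A $ i $ k))\<^sup>2 \<Longrightarrow>
      0 < A $ i $ i \<and> A $ i $ j \<le> 0 \<and> A $ i $ k \<le> 0 \<and>
      (A $ i $ j)\<^sup>2 + (A $ i $ k)\<^sup>2 = (A $ i $ i)\<^sup>2 \<and>
      A $ i $ i * A $ j $ j = (A $ i $ j)\<^sup>2 \<and> A $ i $ i * A $ k $ k = (A $ i $ k)\<^sup>2 \<and>
      A $ i $ i * A $ j $ k = A $ i $ j * A $ i $ k"
proof -
  let ?p = "neg_part (A $ i $ j)" and ?q = "neg_part (A $ i $ k)"
  let ?m = "(A $ i $ i)\<^sup>2 + (A $ j $ j)\<^sup>2 + (A $ k $ k)\<^sup>2 + 2 * (A $ j $ k)\<^sup>2"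
  have N: "trace_inner A A = ?m + 2 * ((A $ i $ j)\<^sup>2 + (A $ i $ k)\<^sup>2)"
    by (simp add: trace_inner_self_3[OF d copositive_symmetric[OF A]])
  have form: "0 \<le> A $ i $ i * t\<^sup>2
      + (A $ j $ j * ?p\<^sup>2 + 2 * A $ j $ k * ?p * ?q + A $ k $ k * ?q\<^sup>2) * z\<^sup>2
      - 2 * (?p\<^sup>2 + ?q\<^sup>2) * t * z" if "0 \<le> t" "0 \<le> z" for t z
  proof -
    have "0 \<le> A $ i $ i * t\<^sup>2 + A $ j $ j * (?p * z)\<^sup>2 + A $ k $ k * (?q * z)\<^sup>2
      + 2 * (A $ i $ j * t * (?p * z) + A $ i $ k * t * (?q * z) + A $ j $ k * (?p * z) * (?q * z))"
      using that by (intro copositive_form_nonneg[OF A d]) auto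
    moreover have "A $ i $ j * t * (?p * z) = - ?p\<^sup>2 * t * z"
      by (simp flip: mult_neg_part)
    moreover have "A $ i $ k * t * (?q * z) = - ?q\<^sup>2 * t * z"
      by (simp flip: mult_neg_part)
    ultimately show ?thesis by (simp add: algebra_simps power2_eq_square)
  qed
  have le: "2 * (?p\<^sup>2 + ?q\<^sup>2) \<le> ?m"
  proof (cases "0 < ?p\<^sup>2 + ?q\<^sup>2")
    case True
    show ?thesis using border_bound(1)[OF form True] by simp
  next
    case False
    then have "?p\<^sup>2 + ?q\<^sup>2 = 0" using zero_le_power2[of ?p] zero_le_power2[of ?q] by argo
    then show ?thesis by (simp only:) simp
  qed
  note sq = neg_part_sq_le[of "A $ i $ j"] neg_part_sq_le[of "A $ i $ k"]
  show "4 * (?p\<^sup>2 + ?q\<^sup>2) \<le> trace_inner A A" using le sq by (simp add: N)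
  assume eq: "4 * (?p\<^sup>2 + ?q\<^sup>2) = trace_inner A A" and pos: "0 < ?p\<^sup>2 + ?q\<^sup>2"
  \<comment> \<open>Equality of the sums forces equality in \<open>le\<close> and in both
    inequalities of \<open>sq\<close>.\<close>
  have m: "2 * (?p\<^sup>2 + ?q\<^sup>2) = ?m" using eq le sq unfolding N by argo
  have p2: "?p\<^sup>2 = (A $ i $ j)\<^sup>2" using eq le sq unfolding N by argo
  have q2: "?q\<^sup>2 = (A $ i $ k)\<^sup>2" using eq le sq unfolding N by argo
  from p2 q2 have p: "A $ i $ j = - ?p" and q: "A $ i $ k = - ?q"
    by (auto simp: neg_part_def max_def power2_eq_iff split: if_splits)
  have "0 < A $ i $ i \<and> ?p\<^sup>2 + ?q\<^sup>2 = (A $ i $ i)\<^sup>2 \<and> A $ i $ i * A $ j $ j = ?p\<^sup>2 \<and>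
      A $ i $ i * A $ k $ k = ?q\<^sup>2 \<and> A $ i $ i * A $ j $ k = ?p * ?q"
    using border_bound(2)[OF form pos] m by simp
  moreover have "A $ i $ j * A $ i $ k = ?p * ?q"
    using arg_cong2[OF p q, of "(*)"] by (simp only: minus_mult_minus)
  moreover have "A $ i $ j \<le> 0" using p neg_part_nonneg[of "A $ i $ j"] by argo
  moreover have "A $ i $ k \<le> 0" using q neg_part_nonneg[of "A $ i $ k"] by argo
  ultimately show "0 < A $ i $ i \<and> A $ i $ j \<le> 0 \<and> A $ i $ k \<le> 0 \<and>
      (A $ i $ j)\<^sup>2 + (A $ i $ k)\<^sup>2 = (A $ i $ i)\<^sup>2 \<and>
      A $ i $ i * A $ j $ j = (A $ i $ j)\<^sup>2 \<and> A $ i $ i * A $ k $ k = (A $ i $ k)\<^sup>2 \<and>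
      A $ i $ i * A $ j $ k = A $ i $ j * A $ i $ k"
    by (simp add: p2 q2)
qed

text \<open>Eliminating index i leaves a binary form with mixed coefficient -(r + w), so (r + w)^2
  \<le> s t. Hence b^2 + c^2 \<ge> s^2 + t^2 + u^2 + v^2 \<ge> 2 r^2 + 4 r w + (u + v)^2, as w^2 = u
  v. The term 4 r w > 0 gives strictness, and 2 (p^2 + q^2) = 2 a (u + v) \<le> a^2 + (u + v)^2
  supplies the rest.\<close>

lemma all_negative_bound:
  fixes A :: "real^3^3"
  assumes A: "A \<in> copositive" and d: "distinct [i, j, k]"
    and neg: "A $ i $ j < 0" "A $ i $ k < 0" "A $ j $ k < 0"
  shows "4 * ((A $ i $ j)\<^sup>2 + (A $ i $ k)\<^sup>2 + (A $ j $ k)\<^sup>2) < trace_inner A A"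
proof -
  define a b c p q r where "a = A $ i $ i" and "b = A $ j $ j" and "c = A $ k $ k"
    and "p = - A $ i $ j" and "q = - A $ i $ k" and "r = - A $ j $ k"
  note defs = a_def b_def c_def p_def q_def r_def
  have pos: "0 < p" "0 < q" "0 < r" using neg by (auto simp: defs)
  have "p\<^sup>2 \<le> a * b" using copositive_minor[OF A, of i j] d neg by (simp add: defs)
  moreover have "0 < p\<^sup>2" using pos by simp
  ultimately have "a \<noteq> 0" by auto
  then have a: "0 < a" using copositive_diag_nonneg[OF A, of i] by (simp add: a_def)
  \<comment> \<open>u, v, w are the entries of the rank one part split off by row i; s, t and -(r +
    w) are those of the Schur complement.\<close>
  define u v w s t where "u = p\<^sup>2 / a" and "v = q\<^sup>2 / a" and "w = p * q / a"
    and "s = b - u" and "t = c - v"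
  have w: "0 < w" "w\<^sup>2 = u * v" using a pos
    by (auto simp: u_def v_def w_def power2_eq_square)
  have form: "0 \<le> s * y\<^sup>2 + t * z\<^sup>2 - 2 * (r + w) * y * z" if "0 \<le> y" "0 \<le> z" for y z
  proof -
    \<comment> \<open>The minimiser of the form in its first coordinate; it is admissible because p
      and q are positive.\<close>
    define x where "x = (p * y + q * z) / a"
    have "0 \<le> x" using a pos that by (simp add: x_def)
    from copositive_form_nonneg[OF A d this that]
    have "0 \<le> a * x\<^sup>2 - 2 * x * (p * y + q * z) + b * y\<^sup>2 + c * z\<^sup>2 - 2 * r * y * z"
      by (simp add: defs algebra_simps)
    also have "p * y + q * z = a * x" using a by (simp add: x_def)
    also have "a * x\<^sup>2 - 2 * x * (a * x) = - (a * x) * x" by (simp add: power2_eq_square)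
    also have "\<dots> = - (p * y + q * z)\<^sup>2 / a"
      using a by (simp add: x_def power2_eq_square field_simps)
    also have "\<dots> = - u * y\<^sup>2 - v * z\<^sup>2 - 2 * w * y * z"
      using a by (simp add: u_def v_def w_def field_simps power2_eq_square)
    finally show ?thesis by (simp add: s_def t_def algebra_simps)
  qed
  have "(r + w)\<^sup>2 \<le> s * t"
    using binary_form_nonneg(3)[of s t "r + w"] form pos w by auto
  moreover have "(s - t)\<^sup>2 \<ge> 0" by simp
  ultimately have st: "2 * (r + w)\<^sup>2 \<le> s\<^sup>2 + t\<^sup>2"
    by (simp add: power2_eq_square algebra_simps)
  have "0 \<le> s" "0 \<le> t"
    using binary_form_nonneg(1,2)[of s t "r + w"] form pos w by auto
  moreover have "0 \<le> u" "0 \<le> v" using a by (auto simp: u_def v_def)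
  ultimately have uv: "0 \<le> u * s" "0 \<le> v * t" by auto
  have "0 < r * w" using pos w by simp
  then have "(u + v)\<^sup>2 + 2 * r\<^sup>2 < b\<^sup>2 + c\<^sup>2"
    using st uv w(2) unfolding s_def t_def
    by (simp add: power2_eq_square algebra_simps)
  moreover have "2 * (p\<^sup>2 + q\<^sup>2) \<le> a\<^sup>2 + (u + v)\<^sup>2"
  proof -
    have "p\<^sup>2 + q\<^sup>2 = a * (u + v)" using a by (simp add: u_def v_def field_simps)
    moreover have "0 \<le> (a - (u + v))\<^sup>2" by simp
    ultimately show ?thesis by (simp add: power2_eq_square algebra_simps)
  qed
  ultimately have "2 * (p\<^sup>2 + q\<^sup>2 + r\<^sup>2) < a\<^sup>2 + b\<^sup>2 + c\<^sup>2" by simp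
  then show ?thesis
    by (simp add: trace_inner_self_3[OF d copositive_symmetric[OF A]] defs)
qed

subsection \<open>Negative inner products\<close>

lemma mult_ge_neg_parts:
  assumes "\<not> (0 < x \<and> y < 0)"
  shows "- (neg_part x * max 0 y) \<le> x * y"
  using assms by (auto simp: neg_part_def max_def mult_nonneg_nonneg mult_nonpos_nonpos not_less)

lemma cauchy_3:
  fixes x y z u v w :: real
  shows "(x * u + y * v + z * w)\<^sup>2 \<le> (x\<^sup>2 + y\<^sup>2 + z\<^sup>2) * (u\<^sup>2 + v\<^sup>2 + w\<^sup>2)"
proof -
  have "(x\<^sup>2 + y\<^sup>2 + z\<^sup>2) * (u\<^sup>2 + v\<^sup>2 + w\<^sup>2) - (x * u + y * v + z * w)\<^sup>2
    = (x * v - y * u)\<^sup>2 + (x * w - z * u)\<^sup>2 + (y * w - z * v)\<^sup>2"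
    by (simp add: power2_eq_square algebra_simps)
  moreover have "0 \<le> \<dots>" by simp
  ultimately show ?thesis by argo
qed

lemma power2_mono_neg:
  fixes x y :: real
  assumes "x < 0" "- x \<le> y"
  shows "x\<^sup>2 \<le> y\<^sup>2"
  using power_mono[of "- x" y 2] assms by simp

section \<open>Opposite signs in one direction only\<close>

lemma one_sided_all_negative:
  fixes A B :: "real^3^3"
  assumes A: "A \<in> copositive" and B: "B \<in> copositive" and d: "distinct [i, j, k]"
    and neg: "A $ i $ j < 0" "A $ i $ k < 0" "A $ j $ k < 0"
    and D: "trace_inner A B < 0"
  shows "2 * (trace_inner A B)\<^sup>2 < trace_inner A A * trace_inner B B"
proof -
  let ?D = "trace_inner A B" and ?a = "4 * ((A $ i $ j)\<^sup>2 + (A $ i $ k)\<^sup>2 + (A $ j $ k)\<^sup>2)"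
  let ?b = "(B $ i $ j)\<^sup>2 + (B $ i $ k)\<^sup>2 + (B $ j $ k)\<^sup>2"
  note sA = copositive_symmetric[OF A] and sB = copositive_symmetric[OF B]
  have diag: "0 \<le> A $ l $ l * B $ l $ l" for l
    using copositive_diag_nonneg[OF A] copositive_diag_nonneg[OF B] by simp
  have "- ?D \<le> - (2 * (A $ i $ j * B $ i $ j + A $ i $ k * B $ i $ k + A $ j $ k * B $ j $ k))"
    using diag[of i] diag[of j] diag[of k] by (simp add: trace_inner_3[OF d sA sB])
  from power2_mono_neg[OF D this]
  have "?D\<^sup>2 \<le> 4 * (A $ i $ j * B $ i $ j + A $ i $ k * B $ i $ k + A $ j $ k * B $ j $ k)\<^sup>2"
    by (simp only: power2_minus power_mult_distrib) simp
  also have "\<dots> \<le> ?a * ?b" using cauchy_3[of "A $ i $ j" "B $ i $ j" "A $ i $ k" "B $ i $ k" "A $ j $ k" "B $ j $ k"]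
    by argo
  finally have D2: "?D\<^sup>2 \<le> ?a * ?b" .
  moreover have "0 < ?D\<^sup>2" using D by simp
  \<comment> \<open>A positive factor is needed to keep the strictness of
    \<open>all_negative_bound\<close> under multiplication.\<close>
  ultimately have "?b \<noteq> 0" by (metis leD mult_zero_right)
  moreover have "0 \<le> ?b" by simp
  ultimately have "0 < ?b" by argo
  then have "?a * ?b < trace_inner A A * ?b"
    using all_negative_bound[OF A d neg] by simp
  moreover have "2 * ?b \<le> trace_inner B B"
    by (simp add: trace_inner_self_3[OF d sB])
  then have "trace_inner A A * (2 * ?b) \<le> trace_inner A A * trace_inner B B"
    by (rule mult_left_mono) (simp add: trace_inner_self_3[OF d sA])
  ultimately show ?thesis using D2 by argo
qed

text \<open>The chain is D^2 \<le> 4 (p u + q v)^2 \<le> 4 (p^2 + q^2) (u^2 + v^2) \<le> NA (u^2 +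
  v^2) \<le> NA NB / 2, where NA, NB are the squared norms. In the equality case every link is
  tight: the second makes (u, v) parallel to (p, q), the third fixes the shape of \<open>A\<close>,
  the last removes all other entries of \<open>B\<close>.\<close>

lemma one_sided_border:
  fixes A B :: "real^3^3"
  assumes A: "A \<in> copositive" and B: "B \<in> copositive" and d: "distinct [i, j, k]"
    and one_sided: "\<And>l m. l \<noteq> m \<Longrightarrow> \<not> (0 < A $ l $ m \<and> B $ l $ m < 0)"
    and jk: "0 \<le> A $ j $ k" and D: "trace_inner A B < 0"
  shows "2 * (trace_inner A B)\<^sup>2 \<le> trace_inner A A * trace_inner B B"
    and "2 * (trace_inner A B)\<^sup>2 = trace_inner A A * trace_inner B B \<Longrightarrow> extremal_pair A B i j k"
proof -
  let ?D = "trace_inner A B" and ?NA = "trace_inner A A" and ?NB = "trace_inner B B"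
  define p q u v where "p = neg_part (A $ i $ j)" and "q = neg_part (A $ i $ k)"
    and "u = max 0 (B $ i $ j)" and "v = max 0 (B $ i $ k)"
  note sA = copositive_symmetric[OF A] and sB = copositive_symmetric[OF B]
  have diag: "0 \<le> A $ l $ l * B $ l $ l" for l
    using copositive_diag_nonneg[OF A] copositive_diag_nonneg[OF B] by simp
  have "- (p * u) \<le> A $ i $ j * B $ i $ j" "- (q * v) \<le> A $ i $ k * B $ i $ k"
    using d mult_ge_neg_parts[OF one_sided] by (auto simp: p_def q_def u_def v_def)
  moreover have "0 \<le> A $ j $ k * B $ j $ k"
    using jk one_sided[of j k] d by (cases "A $ j $ k = 0") auto
  ultimately have le: "- ?D \<le> 2 * (p * u + q * v)"
    using diag[of i] diag[of j] diag[of k] by (simp add: trace_inner_3[OF d sA sB])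
  have lagrange: "(p\<^sup>2 + q\<^sup>2) * (u\<^sup>2 + v\<^sup>2) = (p * u + q * v)\<^sup>2 + (p * v - q * u)\<^sup>2"
    by (simp add: power2_eq_square algebra_simps)
  have D2: "?D\<^sup>2 \<le> 4 * (p * u + q * v)\<^sup>2"
    using power2_mono_neg[OF D le] by (simp only: power_mult_distrib) simp
  have pos: "0 < p * u + q * v" using le D by argo
  have uvB: "u\<^sup>2 \<le> (B $ i $ j)\<^sup>2" "v\<^sup>2 \<le> (B $ i $ k)\<^sup>2"
    by (auto simp: u_def v_def max_def)
  have NB: "?NB = (B $ i $ i)\<^sup>2 + (B $ j $ j)\<^sup>2 + (B $ k $ k)\<^sup>2
      + 2 * ((B $ i $ j)\<^sup>2 + (B $ i $ k)\<^sup>2 + (B $ j $ k)\<^sup>2)"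
    by (rule trace_inner_self_3[OF d sB])
  have NBle: "2 * (u\<^sup>2 + v\<^sup>2) \<le> ?NB" unfolding NB using uvB by (smt (verit) zero_le_power2)
  have NAle: "4 * (p\<^sup>2 + q\<^sup>2) \<le> ?NA"
    using neg_part_bound(1)[OF A d jk] by (simp add: p_def q_def)
  have uv: "0 < u\<^sup>2 + v\<^sup>2" using pos by (auto simp: sum_power2_gt_zero_iff)
  have pq: "0 < p\<^sup>2 + q\<^sup>2" using pos by (auto simp: sum_power2_gt_zero_iff)
  have m1: "8 * ((p\<^sup>2 + q\<^sup>2) * (u\<^sup>2 + v\<^sup>2)) \<le> ?NA * (2 * (u\<^sup>2 + v\<^sup>2))"
    using mult_right_mono[OF NAle, of "2 * (u\<^sup>2 + v\<^sup>2)"] uv by argo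
  have NApos: "0 < ?NA" using NAle pq by argo
  have m2: "?NA * (2 * (u\<^sup>2 + v\<^sup>2)) \<le> ?NA * ?NB"
    using mult_left_mono[OF NBle] NApos by simp
  show "2 * ?D\<^sup>2 \<le> ?NA * ?NB"
    using D2 lagrange m1 m2 zero_le_power2[of "p * v - q * u"] by argo
  assume eq: "2 * ?D\<^sup>2 = ?NA * ?NB"
  then have "?NA * ?NB = ?NA * (2 * (u\<^sup>2 + v\<^sup>2))"
    using D2 lagrange m1 m2 zero_le_power2[of "p * v - q * u"] by argo
  then have NBeq: "?NB = 2 * (u\<^sup>2 + v\<^sup>2)" using NApos by simp
  have "?NA * (2 * (u\<^sup>2 + v\<^sup>2)) = (4 * (p\<^sup>2 + q\<^sup>2)) * (2 * (u\<^sup>2 + v\<^sup>2))"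
    using eq D2 lagrange m1 m2 zero_le_power2[of "p * v - q * u"] by argo
  moreover have "2 * (u\<^sup>2 + v\<^sup>2) \<noteq> 0" using uv by argo
  ultimately have NAeq: "?NA = 4 * (p\<^sup>2 + q\<^sup>2)" by (rule mult_right_cancel[THEN iffD1, rotated])
  have "(p * v - q * u)\<^sup>2 \<le> 0"
    using eq D2 lagrange m1 m2 by argo
  then have par: "p * v = q * u" by simp
  have "(B $ i $ i)\<^sup>2 = 0 \<and> (B $ j $ j)\<^sup>2 = 0 \<and> (B $ k $ k)\<^sup>2 = 0 \<and> (B $ j $ k)\<^sup>2 = 0 \<and>
      (B $ i $ j)\<^sup>2 = u\<^sup>2 \<and> (B $ i $ k)\<^sup>2 = v\<^sup>2"
    using NBeq uvB zero_le_power2[of "B $ i $ i"] zero_le_power2[of "B $ j $ j"]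
      zero_le_power2[of "B $ k $ k"] zero_le_power2[of "B $ j $ k"] unfolding NB by argo
  then have Bz: "B $ i $ i = 0 \<and> B $ j $ j = 0 \<and> B $ k $ k = 0 \<and> B $ j $ k = 0"
    and Bu: "B $ i $ j = u" and Bv: "B $ i $ k = v"
    by (auto simp: u_def v_def max_def power2_eq_iff split: if_splits)
  have Aform: "0 < A $ i $ i \<and> A $ i $ j \<le> 0 \<and> A $ i $ k \<le> 0 \<and>
      (A $ i $ j)\<^sup>2 + (A $ i $ k)\<^sup>2 = (A $ i $ i)\<^sup>2 \<and>
      A $ i $ i * A $ j $ j = (A $ i $ j)\<^sup>2 \<and> A $ i $ i * A $ k $ k = (A $ i $ k)\<^sup>2 \<and>
      A $ i $ i * A $ j $ k = A $ i $ j * A $ i $ k"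
    using neg_part_bound(2)[OF A d jk] NAeq pq by (simp add: p_def q_def)
  then have Ap: "A $ i $ j = - p" and Aq: "A $ i $ k = - q"
    by (auto simp: p_def q_def neg_part_def)
  \<comment> \<open>The projection coefficient of (u, v) on (p, q); unlike u / p or v / q it is
    defined when one of p, q vanishes.\<close>
  define e where "e = (p * u + q * v) / (p\<^sup>2 + q\<^sup>2)"
  have nz: "p\<^sup>2 + q\<^sup>2 \<noteq> 0" using pq by argo
  have "0 < e" using pos pq by (simp add: e_def)
  moreover have "(p * u + q * v) * p = u * (p\<^sup>2 + q\<^sup>2)" using par by algebra
  then have "u = e * p"
    unfolding e_def times_divide_eq_left by (intro eq_divide_imp[OF nz]) simp
  moreover have "(p * u + q * v) * q = v * (p\<^sup>2 + q\<^sup>2)" using par by algebra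
  then have "v = e * q"
    unfolding e_def times_divide_eq_left by (intro eq_divide_imp[OF nz]) simp
  ultimately have "\<exists>e>0. B $ i $ j = - e * A $ i $ j \<and> B $ i $ k = - e * A $ i $ k"
    unfolding Ap Aq Bu Bv by auto
  then show "extremal_pair A B i j k"
    unfolding extremal_pair_def using Aform Bz d sA sB by blast
qed

text \<open>A nonnegative off-diagonal entry can be placed at (j, k), and the two other places then
  form row i. Without such an entry all three are negative.\<close>

lemma one_sided_bound:
  fixes A B :: "real^3^3"
  assumes A: "A \<in> copositive" and B: "B \<in> copositive"
    and one_sided: "\<And>l m. l \<noteq> m \<Longrightarrow> \<not> (0 < A $ l $ m \<and> B $ l $ m < 0)"
    and D: "trace_inner A B < 0"
  shows "2 * (trace_inner A B)\<^sup>2 \<le> trace_inner A A * trace_inner B B \<and>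
    (2 * (trace_inner A B)\<^sup>2 = trace_inner A A * trace_inner B B \<longrightarrow> (\<exists>i j k. extremal_pair A B i j k))"
proof (cases "\<exists>j k. j \<noteq> k \<and> 0 \<le> A $ j $ k")
  case True
  then obtain j k where jk: "j \<noteq> k" "0 \<le> A $ j $ k" by blast
  then obtain i where "distinct [j, k, i]" using third_index by blast
  then have "distinct [i, j, k]" by auto
  from one_sided_border[OF A B this one_sided jk(2) D] show ?thesis by blast
next
  case False
  have "distinct [1, 2, 3 :: 3]" by simp
  from one_sided_all_negative[OF A B this _ _ _ D] False show ?thesis
    by (force simp: not_le)
qed

section \<open>Opposite signs in both directions\<close>

text \<open>
  With \<open>p = -a\<^sub>i\<^sub>j\<close>, \<open>q = a\<^sub>i\<^sub>k\<close>, \<open>s = b\<^sub>i\<^sub>j\<close>, \<open>t = -b\<^sub>i\<^sub>k\<close>: Cauchy-Schwarz for \<open>(2p, \<surd>2 q)\<close> and \<open>(s, \<surd>2 t)\<close>.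
  Strictness comes from the term \<open>a\<^sub>i\<^sub>i b\<^sub>i\<^sub>i > 0\<close>.
\<close>

lemma mixed_1_1:
  fixes A B :: "real^3^3"
  assumes A: "A \<in> copositive" and B: "B \<in> copositive" and d: "distinct [i, j, k]"
    and ij: "A $ i $ j < 0" "0 < B $ i $ j" and ik: "0 < A $ i $ k" "B $ i $ k < 0"
    and jk: "0 \<le> A $ j $ k * B $ j $ k" and D: "trace_inner A B < 0"
  shows "2 * (trace_inner A B)\<^sup>2 < trace_inner A A * trace_inner B B"
proof -
  let ?D = "trace_inner A B"
  note sA = copositive_symmetric[OF A] and sB = copositive_symmetric[OF B]
  define p q s t where "p = - A $ i $ j" and "q = A $ i $ k" and "s = B $ i $ j" and "t = - B $ i $ k"
  note defs = p_def q_def s_def t_def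
  have dA: "0 \<le> A $ l $ l" and dB: "0 \<le> B $ l $ l" for l
    using copositive_diag_nonneg[OF A] copositive_diag_nonneg[OF B] by auto
  have pA: "p\<^sup>2 \<le> A $ i $ i * A $ j $ j" using copositive_minor[OF A, of i j] d ij by (simp add: defs)
  have tB: "t\<^sup>2 \<le> B $ i $ i * B $ k $ k" using copositive_minor[OF B, of i k] d ik by (simp add: defs)
  have "0 < p\<^sup>2" "0 < t\<^sup>2" using ij ik by (auto simp: defs)
  then have "A $ i $ i \<noteq> 0" "B $ i $ i \<noteq> 0" using pA tB by auto
  then have "0 < A $ i $ i * B $ i $ i"
    using dA[of i] dB[of i] by simp
  moreover have "0 \<le> A $ j $ j * B $ j $ j" "0 \<le> A $ k $ k * B $ k $ k" using dA dB by auto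
  ultimately have "- ?D < 2 * p * s + 2 * q * t"
    using jk by (simp add: trace_inner_3[OF d sA sB] defs)
  then have "(- ?D)\<^sup>2 < (2 * p * s + 2 * q * t)\<^sup>2"
    using D by (intro power_strict_mono) auto
  moreover have "(4 * p\<^sup>2 + 2 * q\<^sup>2) * (s\<^sup>2 + 2 * t\<^sup>2) - (2 * p * s + 2 * q * t)\<^sup>2
      = 2 * (2 * p * t - q * s)\<^sup>2"
    by (simp add: power2_eq_square algebra_simps)
  then have "(2 * p * s + 2 * q * t)\<^sup>2 \<le> (4 * p\<^sup>2 + 2 * q\<^sup>2) * (s\<^sup>2 + 2 * t\<^sup>2)"
    using zero_le_power2[of "2 * p * t - q * s"] by argo
  \<comment> \<open>The negative entry gets its second share 2 p^2 from the diagonal, by its minor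
    and AM-GM; the positive entry has only its own two copies. For \<open>B\<close> the weights of
    the two places are interchanged.\<close>
  moreover have "4 * p\<^sup>2 + 2 * q\<^sup>2 \<le> trace_inner A A"
  proof -
    have "0 \<le> (A $ i $ i - A $ j $ j)\<^sup>2" by simp
    then have "2 * p\<^sup>2 \<le> (A $ i $ i)\<^sup>2 + (A $ j $ j)\<^sup>2"
      using pA by (simp add: power2_eq_square algebra_simps)
    then show ?thesis
      using zero_le_power2[of "A $ k $ k"] zero_le_power2[of "A $ j $ k"]
      unfolding trace_inner_self_3[OF d sA] defs power2_minus by argo
  qed
  moreover have "2 * (s\<^sup>2 + 2 * t\<^sup>2) \<le> trace_inner B B"
  proof -
    have "0 \<le> (B $ i $ i - B $ k $ k)\<^sup>2" by simp
    then have "2 * t\<^sup>2 \<le> (B $ i $ i)\<^sup>2 + (B $ k $ k)\<^sup>2"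
      using tB by (simp add: power2_eq_square algebra_simps)
    then show ?thesis
      using zero_le_power2[of "B $ j $ j"] zero_le_power2[of "B $ j $ k"]
      unfolding trace_inner_self_3[OF d sB] defs power2_minus by argo
  qed
  moreover have "0 \<le> trace_inner A A" by (simp add: trace_inner_self_3[OF d sA])
  ultimately have "?D\<^sup>2 < (4 * p\<^sup>2 + 2 * q\<^sup>2) * (s\<^sup>2 + 2 * t\<^sup>2)"
    "(4 * p\<^sup>2 + 2 * q\<^sup>2) * (2 * (s\<^sup>2 + 2 * t\<^sup>2)) \<le> trace_inner A A * trace_inner B B"
    by (auto intro!: mult_mono)
  then show ?thesis by argo
qed

text \<open>
  The part \<open>e = \<surd>(a\<^sub>j\<^sub>j a\<^sub>k\<^sub>k)\<close> of the entry \<open>r = a\<^sub>j\<^sub>k\<close> is harmless, since \<open>2es\<close> is compensated by the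
  diagonal terms. Cauchy-Schwarz is applied to \<open>(2p, 2q, \<surd>2 (r - e))\<close> and \<open>(u, v, \<surd>2 s)\<close>, or
  without the last coordinates if \<open>r \<le> e\<close>.
\<close>

lemma mixed_2_1:
  fixes A B :: "real^3^3"
  assumes A: "A \<in> copositive" and B: "B \<in> copositive" and d: "distinct [i, j, k]"
    and ij: "A $ i $ j < 0" "0 < B $ i $ j" and ik: "A $ i $ k < 0" "0 < B $ i $ k"
    and jk: "0 < A $ j $ k" "B $ j $ k < 0" and D: "trace_inner A B < 0"
  shows "2 * (trace_inner A B)\<^sup>2 < trace_inner A A * trace_inner B B"
proof -
  let ?D = "trace_inner A B" and ?NA = "trace_inner A A" and ?NB = "trace_inner B B"
  note sA = copositive_symmetric[OF A] and sB = copositive_symmetric[OF B]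
  define p q r u v s where "p = - A $ i $ j" and "q = - A $ i $ k" and "r = A $ j $ k"
    and "u = B $ i $ j" and "v = B $ i $ k" and "s = - B $ j $ k"
  define a b c where "a = A $ i $ i" and "b = A $ j $ j" and "c = A $ k $ k"
  note defs = p_def q_def r_def u_def v_def s_def a_def b_def c_def
  have pos: "0 < p" "0 < q" "0 < r" "0 < u" "0 < v" "0 < s" using ij ik jk by (auto simp: defs)
  have dB: "0 \<le> B $ l $ l" for l
    using copositive_diag_nonneg[OF B] by auto
  have dA: "0 \<le> a" "0 \<le> b" "0 \<le> c"
    using copositive_diag_nonneg[OF A] by (auto simp: defs)
  have pA: "p\<^sup>2 \<le> a * b" "q\<^sup>2 \<le> a * c"
    using copositive_minor[OF A, of i j] copositive_minor[OF A, of i k] d ij ik by (auto simp: defs)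
  have sB2: "s\<^sup>2 \<le> B $ j $ j * B $ k $ k"
    using copositive_minor[OF B, of j k] d jk by (simp add: defs)
  have "0 < p\<^sup>2" "0 < q\<^sup>2" using pos by auto
  then have "b \<noteq> 0" "c \<noteq> 0" using pA by auto
  then have bc: "0 < b * c" using dA by simp
  define e where "e = sqrt (b * c)"
  have e: "0 < e" "e\<^sup>2 = b * c" using bc by (auto simp: e_def)
  \<comment> \<open>Expanded, a^2 + b^2 + c^2 + 2 b c \<ge> 2 a (b + c) \<ge> 2 (p^2 + q^2), and 2 b
    c = 2 e^2 is the correction to the weight of r.\<close>
  have "0 \<le> (a - (b + c))\<^sup>2" by simp
  then have NA: "4 * (p\<^sup>2 + q\<^sup>2) + 2 * (r\<^sup>2 - e\<^sup>2) \<le> ?NA"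
    using pA unfolding trace_inner_self_3[OF d sA] e(2)
    by (simp add: defs power2_eq_square algebra_simps)
  have NB: "2 * (u\<^sup>2 + v\<^sup>2 + 2 * s\<^sup>2) \<le> ?NB"
  proof -
    have "0 \<le> (B $ j $ j - B $ k $ k)\<^sup>2" by simp
    then have "2 * s\<^sup>2 \<le> (B $ j $ j)\<^sup>2 + (B $ k $ k)\<^sup>2"
      using sB2 by (simp add: power2_eq_square algebra_simps)
    then show ?thesis
      using zero_le_power2[of "B $ i $ i"]
      unfolding trace_inner_self_3[OF d sB] defs power2_minus by argo
  qed
  have es: "2 * e * s \<le> b * B $ j $ j + c * B $ k $ k"
  proof (rule power2_le_imp_le)
    have "(2 * e * s)\<^sup>2 = 4 * (b * c * s\<^sup>2)" by (simp add: power_mult_distrib e)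
    also have "\<dots> \<le> 4 * (b * c * (B $ j $ j * B $ k $ k))"
      using sB2 bc by (simp only: mult_le_cancel_left_pos)
    also have "\<dots> = (b * B $ j $ j + c * B $ k $ k)\<^sup>2 - (b * B $ j $ j - c * B $ k $ k)\<^sup>2"
      by (simp add: power2_eq_square algebra_simps)
    also have "\<dots> \<le> (b * B $ j $ j + c * B $ k $ k)\<^sup>2" by simp
    finally show "(2 * e * s)\<^sup>2 \<le> (b * B $ j $ j + c * B $ k $ k)\<^sup>2" .
    show "0 \<le> b * B $ j $ j + c * B $ k $ k" using dA dB by simp
  qed
  have "0 \<le> a * B $ i $ i" using dA dB by simp
  then have Dle: "- ?D \<le> 2 * p * u + 2 * q * v + 2 * (r - e) * s"
    using es by (simp add: trace_inner_3[OF d sA sB] defs algebra_simps)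
  show ?thesis
  proof (cases "e < r")
    case True
    define f where "f = r - e"
    have "0 < f" using True by (simp add: f_def)
    \<comment> \<open>The surplus 2 f e is the source of strictness in this case.\<close>
    have "r\<^sup>2 - e\<^sup>2 = f\<^sup>2 + 2 * f * e" by (simp add: f_def power2_eq_square algebra_simps)
    moreover have "0 < f * e" using \<open>0 < f\<close> e by simp
    ultimately have NA': "4 * (p\<^sup>2 + q\<^sup>2) + 2 * f\<^sup>2 < ?NA" using NA by simp
    have "?D\<^sup>2 \<le> (2 * p * u + 2 * q * v + 2 * f * s)\<^sup>2"
      using power2_mono_neg[OF D Dle] by (simp add: f_def)
    also have "\<dots> = ((2 * p) * u + (2 * q) * v + (sqrt 2 * f) * (sqrt 2 * s))\<^sup>2"
    proof -
      have "(sqrt 2 * f) * (sqrt 2 * s) = (sqrt 2 * sqrt 2) * f * s" by (simp only: ac_simps)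
      also have "\<dots> = 2 * f * s" by simp
      finally show ?thesis by (simp only:)
    qed
    also have "\<dots> \<le> ((2 * p)\<^sup>2 + (2 * q)\<^sup>2 + (sqrt 2 * f)\<^sup>2) * (u\<^sup>2 + v\<^sup>2 + (sqrt 2 * s)\<^sup>2)"
      by (rule cauchy_3)
    also have "\<dots> = (4 * (p\<^sup>2 + q\<^sup>2) + 2 * f\<^sup>2) * (u\<^sup>2 + v\<^sup>2 + 2 * s\<^sup>2)"
      by (simp add: power_mult_distrib)
    also have "\<dots> < ?NA * (u\<^sup>2 + v\<^sup>2 + 2 * s\<^sup>2)"
      using NA' pos by (intro mult_strict_right_mono) (auto intro!: add_pos_pos)
    finally have "?D\<^sup>2 < ?NA * (u\<^sup>2 + v\<^sup>2 + 2 * s\<^sup>2)" .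
    moreover have "?NA * (2 * (u\<^sup>2 + v\<^sup>2 + 2 * s\<^sup>2)) \<le> ?NA * ?NB"
      using NB by (rule mult_left_mono) (simp add: trace_inner_self_3[OF d sA])
    ultimately show ?thesis by argo
  next
    case False
    then have "(r - e) * s \<le> 0" using pos by (simp add: mult_nonpos_nonneg)
    then have "- ?D \<le> 2 * p * u + 2 * q * v" using Dle by argo
    from power2_mono_neg[OF D this]
    have "?D\<^sup>2 \<le> ((2 * p) * u + (2 * q) * v + 0 * 0)\<^sup>2" by simp
    also have "\<dots> \<le> ((2 * p)\<^sup>2 + (2 * q)\<^sup>2 + 0\<^sup>2) * (u\<^sup>2 + v\<^sup>2 + 0\<^sup>2)"
      by (rule cauchy_3)
    also have "\<dots> = (4 * (p\<^sup>2 + q\<^sup>2)) * (u\<^sup>2 + v\<^sup>2)"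
      by (simp add: power_mult_distrib)
    \<comment> \<open>Here strictness comes from s > 0, which the two-term Cauchy-Schwarz did not
      use.\<close>
    also have "\<dots> < (4 * (p\<^sup>2 + q\<^sup>2)) * (u\<^sup>2 + v\<^sup>2 + 2 * s\<^sup>2)"
      using pos by (intro mult_strict_left_mono) (auto intro!: add_pos_pos)
    finally have "?D\<^sup>2 < (4 * (p\<^sup>2 + q\<^sup>2)) * (u\<^sup>2 + v\<^sup>2 + 2 * s\<^sup>2)" .
    moreover have "4 * (p\<^sup>2 + q\<^sup>2) \<le> ?NA"
      using neg_part_bound(1)[OF A d] jk ij ik by (simp add: defs neg_part_def)
    then have "(4 * (p\<^sup>2 + q\<^sup>2)) * (2 * (u\<^sup>2 + v\<^sup>2 + 2 * s\<^sup>2)) \<le> ?NA * ?NB"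
      using NB by (intro mult_mono) (auto simp: trace_inner_self_3[OF d sA])
    ultimately show ?thesis by argo
  qed
qed

text \<open>The place (j, k) decides. If the signs are opposite there too, it joins one of the two
  directions: the negative entries of \<open>A\<close> then meet in row j, or those of
  \<open>B\<close> meet in row k with the matrices exchanged.\<close>

lemma two_sided_bound:
  fixes A B :: "real^3^3"
  assumes A: "A \<in> copositive" and B: "B \<in> copositive" and d: "distinct [i, j, k]"
    and ij: "A $ i $ j < 0" "0 < B $ i $ j" and ik: "0 < A $ i $ k" "B $ i $ k < 0"
    and D: "trace_inner A B < 0"
  shows "2 * (trace_inner A B)\<^sup>2 < trace_inner A A * trace_inner B B"
proof -
  note sA = symmetric_matrix_nth[OF copositive_symmetric[OF A]]
    and sB = symmetric_matrix_nth[OF copositive_symmetric[OF B]]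
  consider "0 \<le> A $ j $ k * B $ j $ k" | "A $ j $ k < 0" "0 < B $ j $ k" | "0 < A $ j $ k" "B $ j $ k < 0"
    by (metis mult_less_0_iff not_le)
  then show ?thesis
  proof cases
    case 1
    show ?thesis using mixed_1_1[OF A B d ij ik 1 D] .
  next
    case 2
    have "distinct [j, i, k]" using d by auto
    from mixed_2_1[OF A B this] show ?thesis
      using ij ik 2 D sA[of j i] sB[of j i] by simp
  next
    case 3
    have "distinct [k, i, j]" using d by auto
    from mixed_2_1[OF B A this] show ?thesis
      using ij ik 3 D sA[of k i] sB[of k i] sA[of k j] sB[of k j]
      by (simp add: trace_inner_commute[of B A] mult.commute)
  qed
qed

lemma copositive_inner_bound:
  fixes A B :: "real^3^3"
  assumes A: "A \<in> copositive" and B: "B \<in> copositive" and D: "trace_inner A B < 0"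
  shows "2 * (trace_inner A B)\<^sup>2 \<le> trace_inner A A * trace_inner B B \<and>
    (2 * (trace_inner A B)\<^sup>2 = trace_inner A A * trace_inner B B \<longrightarrow>
      (\<exists>i j k. extremal_pair A B i j k \<or> extremal_pair B A i j k))"
proof -
  note sA = symmetric_matrix_nth[OF copositive_symmetric[OF A]]
    and sB = symmetric_matrix_nth[OF copositive_symmetric[OF B]]
  consider "\<And>l m. l \<noteq> m \<Longrightarrow> \<not> (0 < A $ l $ m \<and> B $ l $ m < 0)"
    | "\<And>l m. l \<noteq> m \<Longrightarrow> \<not> (0 < B $ l $ m \<and> A $ l $ m < 0)"
    | l m n n' where "l \<noteq> m" "0 < A $ l $ m" "B $ l $ m < 0" "n \<noteq> n'" "A $ n $ n' < 0" "0 < B $ n $ n'"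
    by blast
  then show ?thesis
  proof cases
    case 1
    then show ?thesis using one_sided_bound[OF A B _ D] by blast
  next
    case 2
    then show ?thesis using one_sided_bound[OF B A 2] D
      by (metis trace_inner_commute mult.commute)
  next
    case (3 l m n n')
    \<comment> \<open>The places (l, m) and (n, n') differ by their signs, so they share exactly one
      index, which becomes i.\<close>
    obtain i j k where "distinct [i, j, k]"
      and "A $ i $ j < 0" "0 < B $ i $ j" "0 < A $ i $ k" "B $ i $ k < 0"
    proof -
      obtain x where x: "distinct [l, m, x]" using third_index[OF 3(1)] .
      have U: "n = l \<or> n = m \<or> n = x" "n' = l \<or> n' = m \<or> n' = x"
        using UNIV_3_distinct[OF x] by blast+
      have "(A $ l $ x < 0 \<and> 0 < B $ l $ x) \<or> (A $ m $ x < 0 \<and> 0 < B $ m $ x)"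
        using U 3 sA[of m l] sA[of x l] sB[of x l] sA[of x m] sB[of x m] by auto
      then show ?thesis
      proof
        assume "A $ l $ x < 0 \<and> 0 < B $ l $ x"
        then show ?thesis using 3 x that[of l x m] by auto
      next
        assume "A $ m $ x < 0 \<and> 0 < B $ m $ x"
        then show ?thesis using 3 x sA[of m l] sB[of m l] that[of m x l] by auto
      qed
    qed
    from two_sided_bound[OF A B this D] show ?thesis by simp
  qed
qed

subsection \<open>The extremal pairs\<close>

lemma extremal_pair_copositive:
  assumes "extremal_pair A B i j k"
  shows "A \<in> copositive" and "B \<in> copositive"
proof -
  note e = assms[unfolded extremal_pair_def]
  have d: "distinct [i, j, k]" and sA: "symmetric_matrix A" and sB: "symmetric_matrix B"
    using e by auto
  have a: "0 < A $ i $ i" using e by simp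
  show "A \<in> copositive"
    unfolding copositive_def
  proof (intro CollectI conjI allI impI sA)
    fix v :: "real^3"
    \<comment> \<open>Multiplied by \<open>A $ i $ i\<close>, the form is the square of row i
      applied to v.\<close>
    have "A $ i $ i * (v \<bullet> (A *v v)) = (A $ i $ i * v $ i)\<^sup>2
        + (A $ i $ i * A $ j $ j) * (v $ j)\<^sup>2 + (A $ i $ i * A $ k $ k) * (v $ k)\<^sup>2
        + 2 * (A $ i $ i * v $ i * (A $ i $ j * v $ j) + A $ i $ i * v $ i * (A $ i $ k * v $ k)
          + (A $ i $ i * A $ j $ k) * v $ j * v $ k)"
      by (simp add: quadratic_form_3[OF d sA] power2_eq_square algebra_simps)
    also have "\<dots> = (A $ i $ i * v $ i + A $ i $ j * v $ j + A $ i $ k * v $ k)\<^sup>2"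
    proof -
      have "A $ i $ i * A $ j $ j = (A $ i $ j)\<^sup>2" "A $ i $ i * A $ k $ k = (A $ i $ k)\<^sup>2"
        "A $ i $ i * A $ j $ k = A $ i $ j * A $ i $ k"
        using e by auto
      then show ?thesis by (simp only:) (simp add: power2_eq_square algebra_simps)
    qed
    finally have "0 \<le> A $ i $ i * (v \<bullet> (A *v v))" by simp
    then show "0 \<le> v \<bullet> (A *v v)" using a by (simp add: zero_le_mult_iff)
  qed
  have "0 \<le> B $ i $ j" "0 \<le> B $ i $ k"
    using e by (auto simp: mult_nonneg_nonpos)
  then show "B \<in> copositive"
    using e by (simp add: copositive_def quadratic_form_3[OF d sB])
qed

text \<open>The entries enter only through p^2 + q^2 = a^2: the squared norms are 4 a^2 and 2 c^2
  a^2, the inner product is -2 c a^2.\<close>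

lemma extremal_pair_inner:
  assumes "extremal_pair A B i j k"
  shows "trace_inner A B < 0" and "2 * (trace_inner A B)\<^sup>2 = trace_inner A A * trace_inner B B"
proof -
  note e = assms[unfolded extremal_pair_def]
  have d: "distinct [i, j, k]" and sA: "symmetric_matrix A" and sB: "symmetric_matrix B"
    using e by auto
  obtain c where c: "0 < c" "B $ i $ j = - c * A $ i $ j" "B $ i $ k = - c * A $ i $ k"
    using e by auto
  define a p q where "a = A $ i $ i" and "p = A $ i $ j" and "q = A $ i $ k"
  have a: "0 < a" and pq: "p\<^sup>2 + q\<^sup>2 = a\<^sup>2"
    using e by (auto simp: a_def p_def q_def)
  have "A $ j $ j = p\<^sup>2 / a" "A $ k $ k = q\<^sup>2 / a" "A $ j $ k = p * q / a"
    using e a by (auto simp: a_def p_def q_def field_simps)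
  then have "trace_inner A A = a\<^sup>2 + (p\<^sup>2 + q\<^sup>2)\<^sup>2 / a\<^sup>2 + 2 * (p\<^sup>2 + q\<^sup>2)"
    using a by (simp add: trace_inner_self_3[OF d sA] flip: a_def p_def q_def)
      (simp add: field_simps power2_eq_square)
  then have A: "trace_inner A A = 4 * a\<^sup>2"
    using a by (simp only: pq) (simp add: power2_eq_square)
  have Bz: "B $ i $ i = 0" "B $ j $ j = 0" "B $ k $ k = 0" "B $ j $ k = 0" using e by auto
  have "trace_inner B B = 2 * c\<^sup>2 * (p\<^sup>2 + q\<^sup>2)"
    by (simp add: trace_inner_self_3[OF d sB] Bz c p_def q_def power_mult_distrib algebra_simps)
  then have B: "trace_inner B B = 2 * c\<^sup>2 * a\<^sup>2" by (simp add: pq)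
  have "trace_inner A B = - 2 * c * (p\<^sup>2 + q\<^sup>2)"
    by (simp add: trace_inner_3[OF d sA sB] Bz c p_def q_def power2_eq_square algebra_simps)
  then have D: "trace_inner A B = - 2 * c * a\<^sup>2" by (simp add: pq)
  show "trace_inner A B < 0" using a c by (simp add: D)
  show "2 * (trace_inner A B)\<^sup>2 = trace_inner A A * trace_inner B B"
    unfolding A B D by (simp add: power2_eq_square)
qed

section \<open>Permutation and scaling in coordinates\<close>

lemma permute_matrix_nth:
  fixes P M :: "real^'n^'n"
  assumes p: "p permutes UNIV" and P: "P = (\<chi> i j. if j = p i then 1 else 0)"
  shows "(transpose P ** M ** P) $ p s $ p t = M $ s $ t"
proof -
  have inj: "p x = p y \<longleftrightarrow> x = y" for x y
    using permutes_inj[OF p] by (auto dest: injD)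
  have 1: "(transpose P ** M) $ p s $ y = M $ s $ y" for y
    by (simp add: matrix_matrix_mult_def transpose_def P inj if_distrib[of "\<lambda>x. x * _"]
        cong: if_cong)
  have 2: "(N ** P) $ x $ p t = N $ x $ t" for N :: "real^'n^'n" and x
    by (simp add: matrix_matrix_mult_def P inj if_distrib[of "\<lambda>x. _ * x"] cong: if_cong)
  show ?thesis by (simp only: 1 2)
qed

lemma extremal_A_nth:
  "extremal_A a b $ 1 $ 1 = 1 / 2" "extremal_A a b $ 1 $ 2 = - sqrt (a / 2)"
  "extremal_A a b $ 1 $ 3 = - sqrt (b / 2)" "extremal_A a b $ 2 $ 1 = - sqrt (a / 2)"
  "extremal_A a b $ 2 $ 2 = a" "extremal_A a b $ 2 $ 3 = sqrt (a * b)"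
  "extremal_A a b $ 3 $ 1 = - sqrt (b / 2)" "extremal_A a b $ 3 $ 2 = sqrt (a * b)"
  "extremal_A a b $ 3 $ 3 = b"
  by (simp_all add: extremal_A_def)

lemma extremal_B_nth:
  "extremal_B a b $ 1 $ 1 = 0" "extremal_B a b $ 1 $ 2 = sqrt a"
  "extremal_B a b $ 1 $ 3 = sqrt b" "extremal_B a b $ 2 $ 1 = sqrt a"
  "extremal_B a b $ 2 $ 2 = 0" "extremal_B a b $ 2 $ 3 = 0"
  "extremal_B a b $ 3 $ 1 = sqrt b" "extremal_B a b $ 3 $ 2 = 0"
  "extremal_B a b $ 3 $ 3 = 0"
  by (simp_all add: extremal_B_def)

text \<open>Conjugation by P moves the entry at (s, t) to (p s, p t). Indexing the result by p s and
  p t avoids the inverse permutation and matches the free indices of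
  \<open>extremal_pair\<close>.\<close>

lemma perm_scale_equiv_iff:
  fixes A B A' B' :: "real^'n^'n"
  shows "perm_scale_equiv (A, B) (A', B') \<longleftrightarrow>
    (\<exists>p c d. p permutes UNIV \<and> 0 < c \<and> 0 < d \<and>
      (\<forall>s t. A' $ p s $ p t = c * A $ s $ t \<and> B' $ p s $ p t = d * B $ s $ t))"
proof
  assume "perm_scale_equiv (A, B) (A', B')"
  then show "\<exists>p c d. p permutes UNIV \<and> 0 < c \<and> 0 < d \<and>
      (\<forall>s t. A' $ p s $ p t = c * A $ s $ t \<and> B' $ p s $ p t = d * B $ s $ t)"
  proof -
    obtain P c d p where p: "p permutes UNIV" and P: "P = (\<chi> i j. if j = p i then 1 else 0)"
      and cd: "0 < c" "0 < d"
      and eq: "A' = c *\<^sub>R (transpose P ** A ** P)" "B' = d *\<^sub>R (transpose P ** B ** P)"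
      using \<open>perm_scale_equiv (A, B) (A', B')\<close>
      unfolding perm_scale_equiv_def permutation_matrix_def by blast
    have "A' $ p s $ p t = c * A $ s $ t \<and> B' $ p s $ p t = d * B $ s $ t" for s t
      by (simp add: eq permute_matrix_nth[OF p P])
    then show ?thesis using p cd by blast
  qed
next
  assume "\<exists>p c d. p permutes UNIV \<and> 0 < c \<and> 0 < d \<and>
      (\<forall>s t. A' $ p s $ p t = c * A $ s $ t \<and> B' $ p s $ p t = d * B $ s $ t)"
  then obtain p c d where p: "p permutes UNIV" and cd: "0 < c" "0 < d"
    and nth: "\<And>s t. A' $ p s $ p t = c * A $ s $ t" "\<And>s t. B' $ p s $ p t = d * B $ s $ t"
    by auto
  define P :: "real^'n^'n" where "P = (\<chi> i j. if j = p i then 1 else 0)"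
  have eq: "M' = m *\<^sub>R (transpose P ** M ** P)"
    if "\<And>s t. M' $ p s $ p t = m * M $ s $ t" for m and M M' :: "real^'n^'n"
    unfolding vec_eq_iff
  proof (intro allI)
    fix x y
    obtain s t where "x = p s" "y = p t" using permutes_surj[OF p] by (metis surjD)
    then show "M' $ x $ y = (m *\<^sub>R (transpose P ** M ** P)) $ x $ y"
      by (simp add: that permute_matrix_nth[OF p P_def])
  qed
  have "A' = c *\<^sub>R (transpose P ** A ** P)" "B' = d *\<^sub>R (transpose P ** B ** P)"
    using nth by (auto intro!: eq)
  moreover have "permutation_matrix P"
    using p P_def by (auto simp: permutation_matrix_def)
  ultimately show "perm_scale_equiv (A, B) (A', B')"
    using cd by (auto simp: perm_scale_equiv_def)
qed

lemma perm_scale_extremal_imp_pair: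
  assumes ab: "0 \<le> a" "0 \<le> b" "a + b = 1 / 2"
    and "perm_scale_equiv (extremal_A a b, extremal_B a b) (A, B)"
  shows "\<exists>i j k. extremal_pair A B i j k"
proof -
  obtain p c d where p: "p permutes UNIV" and cd: "0 < c" "0 < d"
    and nth: "\<And>s t. A $ p s $ p t = c * extremal_A a b $ s $ t"
      "\<And>s t. B $ p s $ p t = d * extremal_B a b $ s $ t"
    using assms(4) unfolding perm_scale_equiv_iff by blast
  have inj: "p x = p y \<longleftrightarrow> x = y" for x y
    using permutes_inj[OF p] by (auto dest: injD)
  have surj: "\<exists>s. x = p s" for x
    using permutes_surj[OF p] by (metis surjD)
  have symm: "symmetric_matrix M"
    if "\<And>s t. M $ p s $ p t = M $ p t $ p s" for M :: "real^3^3"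
    unfolding symmetric_matrix_def transpose_def vec_eq_iff
  proof (intro allI)
    fix x y
    obtain s t where "x = p s" "y = p t" using surj by blast
    then show "(\<chi> i j. M $ j $ i) $ x $ y = M $ x $ y" using that by simp
  qed
  have diag: "c * (1 / 2) * (c * x) = (c * - sqrt (x / 2))\<^sup>2" if "0 \<le> x" for x
  proof -
    have "(c * - sqrt (x / 2))\<^sup>2 = c\<^sup>2 * (x / 2)" using that by (simp add: power_mult_distrib)
    also have "\<dots> = c * (1 / 2) * (c * x)" by (simp add: power2_eq_square)
    finally show ?thesis by (rule sym)
  qed
  have "extremal_A a b $ s $ t = extremal_A a b $ t $ s" "extremal_B a b $ s $ t = extremal_B a b $ t $ s"
    for s t
    using exhaust_3[of s] exhaust_3[of t] by (auto simp: extremal_A_nth extremal_B_nth)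
  then have "symmetric_matrix A" "symmetric_matrix B"
    by (auto intro!: symm simp: nth)
  moreover have "0 < c * (1 / 2)" "c * - sqrt (a / 2) \<le> 0" "c * - sqrt (b / 2) \<le> 0"
    using ab cd by auto
  moreover have "c * (1 / 2) * (c * a) = (c * - sqrt (a / 2))\<^sup>2"
    "c * (1 / 2) * (c * b) = (c * - sqrt (b / 2))\<^sup>2"
    using diag ab by auto
  moreover have "(c * - sqrt (a / 2))\<^sup>2 + (c * - sqrt (b / 2))\<^sup>2 = (c * (1 / 2))\<^sup>2"
  proof -
    have "(c * - sqrt (a / 2))\<^sup>2 + (c * - sqrt (b / 2))\<^sup>2 = c\<^sup>2 / 2 * (a + b)"
      using ab by (simp add: power_mult_distrib algebra_simps)
    then show ?thesis using ab by (simp add: power2_eq_square)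
  qed
  moreover have "c * (1 / 2) * (c * sqrt (a * b)) = c * - sqrt (a / 2) * (c * - sqrt (b / 2))"
    by (simp add: real_sqrt_mult real_sqrt_divide)
  moreover have "\<exists>e>0. d * sqrt a = - e * (c * - sqrt (a / 2)) \<and> d * sqrt b = - e * (c * - sqrt (b / 2))"
    \<comment> \<open>The witness is the quotient of d sqrt a by c sqrt (a / 2).\<close>
    using cd by (intro exI[of _ "d * sqrt 2 / c"]) (simp add: real_sqrt_divide)
  moreover have "distinct [p 1, p 2, p 3]" by (simp add: inj)
  \<comment> \<open>After unfolding, the zero entries of \<open>B\<close> read \<open>d * 0\<close>,
    and the conjuncts are closed by literal matching.\<close>
  moreover have "d * 0 = 0" by simp
  ultimately have "extremal_pair A B (p 1) (p 2) (p 3)"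
    unfolding extremal_pair_def nth extremal_A_nth extremal_B_nth
    by - (intro conjI; assumption)
  then show ?thesis by blast
qed

lemma extremal_pair_imp_perm_scale:
  assumes "extremal_pair A B i j k"
  shows "\<exists>a b. 0 \<le> a \<and> 0 \<le> b \<and> a + b = 1 / 2 \<and>
    perm_scale_equiv (extremal_A a b, extremal_B a b) (A, B)"
proof -
  note e = assms[unfolded extremal_pair_def]
  have d: "distinct [i, j, k]" and sA: "symmetric_matrix A" and sB: "symmetric_matrix B"
    using e by auto
  obtain c where c: "0 < c" "B $ i $ j = - c * A $ i $ j" "B $ i $ k = - c * A $ i $ k"
    using e by auto
  define m u v where "m = A $ i $ i" and "u = - A $ i $ j" and "v = - A $ i $ k"
  have m: "0 < m" and uv: "0 \<le> u" "0 \<le> v" and sum: "u\<^sup>2 + v\<^sup>2 = m\<^sup>2"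
    and A: "A $ i $ i = m" "A $ i $ j = - u" "A $ i $ k = - v"
      "A $ j $ j = u\<^sup>2 / m" "A $ k $ k = v\<^sup>2 / m" "A $ j $ k = u * v / m"
    and B: "B $ i $ i = 0" "B $ j $ j = 0" "B $ k $ k = 0" "B $ j $ k = 0"
      "B $ i $ j = c * u" "B $ i $ k = c * v"
    using e c by (auto simp: m_def u_def v_def field_simps)
  \<comment> \<open>Dividing \<open>A\<close> by 2 m brings its (i, i) entry to 1 / 2; a and b are
    the other diagonal entries after that scaling. The factor sqrt 2 m c for \<open>B\<close> is
    then c u / sqrt a, for nonzero u.\<close>
  define a b where "a = u\<^sup>2 / (2 * m\<^sup>2)" and "b = v\<^sup>2 / (2 * m\<^sup>2)"
  have ab: "0 \<le> a" "0 \<le> b" "a + b = 1 / 2"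
    using m sum by (auto simp: a_def b_def simp flip: add_divide_distrib)
  have half: "sqrt (a / 2) = u / (2 * m)" "sqrt (b / 2) = v / (2 * m)"
    using m uv by (auto intro!: real_sqrt_unique simp: a_def b_def power_divide power_mult_distrib)
  have ab_sqrt: "sqrt (a * b) = u * v / (2 * m\<^sup>2)"
    using m uv by (intro real_sqrt_unique)
      (auto simp: a_def b_def power_divide power_mult_distrib power2_eq_square)
  have s: "sqrt a = u / (sqrt 2 * m)" "sqrt b = v / (sqrt 2 * m)"
    using m uv by (auto intro!: real_sqrt_unique simp: a_def b_def power_divide power_mult_distrib)
  define p where "p = (\<lambda>s :: 3. if s = 1 then i else if s = 2 then j else k)"
  have p123: "p 1 = i" "p 2 = j" "p 3 = k" by (auto simp: p_def)
  have "inj p"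
  proof (rule injI)
    fix x y assume "p x = p y"
    then show "x = y"
      using exhaust_3[of x] exhaust_3[of y] d by (elim disjE) (simp_all add: p123)
  qed
  then have "p permutes UNIV"
    by (intro bij_imp_permutes) (auto simp: bij_betw_def finite_UNIV_inj_surj)
  moreover have "A $ p s $ p t = (2 * m) * extremal_A a b $ s $ t" for s t
    using exhaust_3[of s] exhaust_3[of t] m
      symmetric_matrix_nth[OF sA, of j i] symmetric_matrix_nth[OF sA, of k i]
      symmetric_matrix_nth[OF sA, of k j]
    by (elim disjE) (simp_all add: p123 extremal_A_nth A half ab_sqrt,
        simp_all add: a_def b_def power2_eq_square)
  moreover have "B $ p s $ p t = (sqrt 2 * m * c) * extremal_B a b $ s $ t" for s t
    using exhaust_3[of s] exhaust_3[of t] m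
      symmetric_matrix_nth[OF sB, of j i] symmetric_matrix_nth[OF sB, of k i]
      symmetric_matrix_nth[OF sB, of k j]
    by (elim disjE) (simp_all add: p123 extremal_B_nth B s)
  moreover have "0 < 2 * m" "0 < sqrt 2 * m * c" using m c by auto
  ultimately have "perm_scale_equiv (extremal_A a b, extremal_B a b) (A, B)"
    unfolding perm_scale_equiv_iff by blast
  then show ?thesis using ab by blast
qed

subsection \<open>Angles\<close>

lemma trace_inner_eq_inner:
  fixes A B :: "real^'n^'n"
  assumes "symmetric_matrix B"
  shows "trace_inner A B = A \<bullet> B"
proof -
  have "B $ j $ i = B $ i $ j" for i j by (rule symmetric_matrix_nth[OF assms])
  then show ?thesis unfolding trace_inner_sum inner_vec_def by (simp only: inner_real_def)
qed

lemma frobenius_norm_eq_norm: "symmetric_matrix A \<Longrightarrow> frobenius_norm A = norm A"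
  by (simp add: frobenius_norm_def trace_inner_eq_inner norm_eq_sqrt_inner)

lemma cos_3pi_4: "cos (3 * pi / 4) = - (sqrt 2 / 2)"
proof -
  have "cos (3 * pi / 4) = cos (pi - pi / 4)" by (simp add: field_simps)
  also have "\<dots> = - (sqrt 2 / 2)" by (simp only: cos_pi_minus cos_45)
  finally show ?thesis .
qed

text \<open>By Cauchy-Schwarz the quotient lies in [-1, 1], where arccos is strictly decreasing, so
  it is compared with cos (3 pi / 4) = - sqrt 2 / 2. Squaring is legitimate only for a negative
  inner product; otherwise the angle is at most pi / 2.\<close>

lemma matrix_angle_bound_iff:
  fixes A B :: "real^'n^'n"
  assumes sA: "symmetric_matrix A" and sB: "symmetric_matrix B" and "A \<noteq> 0" "B \<noteq> 0"
  shows "matrix_angle A B \<le> 3 * pi / 4 \<longleftrightarrow>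
      (trace_inner A B < 0 \<longrightarrow> 2 * (trace_inner A B)\<^sup>2 \<le> trace_inner A A * trace_inner B B)"
    and "matrix_angle A B = 3 * pi / 4 \<longleftrightarrow>
      trace_inner A B < 0 \<and> 2 * (trace_inner A B)\<^sup>2 = trace_inner A A * trace_inner B B"
proof -
  define D N where "D = trace_inner A B" and "N = norm A * norm B"
  have N: "0 < N" using assms by (simp add: N_def)
  have N2: "N\<^sup>2 = trace_inner A A * trace_inner B B"
    unfolding N_def power_mult_distrib power2_norm_eq_inner
      trace_inner_eq_inner[OF sA] trace_inner_eq_inner[OF sB] ..
  have angle: "matrix_angle A B = arccos (D / N)"
    by (simp add: matrix_angle_def D_def N_def frobenius_norm_eq_norm sA sB)
  have "\<bar>D\<bar> \<le> N"
    using Cauchy_Schwarz_ineq2[of A B] by (simp add: D_def N_def trace_inner_eq_inner[OF sB])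
  then have le1: "\<bar>D / N\<bar> \<le> 1" using N by (simp add: abs_divide)
  have arc: "3 * pi / 4 = arccos (- (sqrt 2 / 2))"
    unfolding cos_3pi_4[symmetric] by (rule arccos_cos[symmetric]) (simp_all add: field_simps)
  have s2: "\<bar>- (sqrt 2 / 2)\<bar> \<le> 1"
    by (metis abs_cos_le_one cos_3pi_4)
  have div: "- (sqrt 2 / 2) \<le> D / N \<longleftrightarrow> sqrt 2 * (- D) \<le> N"
    "- (sqrt 2 / 2) = D / N \<longleftrightarrow> sqrt 2 * (- D) = N"
  proof -
    have "- (sqrt 2 / 2) \<le> D / N \<longleftrightarrow> - (sqrt 2 / 2) * N \<le> D"
      using N by (simp add: pos_le_divide_eq)
    also have "\<dots> \<longleftrightarrow> - D \<le> sqrt 2 / 2 * N" by argo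
    also have "\<dots> \<longleftrightarrow> sqrt 2 * (- D) \<le> sqrt 2 * (sqrt 2 / 2 * N)"
      by (rule mult_le_cancel_left_pos[symmetric]) simp
    also have "sqrt 2 * (sqrt 2 / 2 * N) = N" by simp
    finally show "- (sqrt 2 / 2) \<le> D / N \<longleftrightarrow> sqrt 2 * (- D) \<le> N" .
    have "- (sqrt 2 / 2) = D / N \<longleftrightarrow> - (sqrt 2 / 2) * N = D"
      using N by (simp add: eq_divide_eq)
    also have "\<dots> \<longleftrightarrow> - D = sqrt 2 / 2 * N" by argo
    also have "\<dots> \<longleftrightarrow> sqrt 2 * (- D) = sqrt 2 * (sqrt 2 / 2 * N)"
      by (rule mult_left_cancel[symmetric]) simp
    also have "sqrt 2 * (sqrt 2 / 2 * N) = N" by simp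
    finally show "- (sqrt 2 / 2) = D / N \<longleftrightarrow> sqrt 2 * (- D) = N" .
  qed
  have pow: "(sqrt 2 * (- D))\<^sup>2 = 2 * D\<^sup>2" by (simp add: power_mult_distrib)
  have "arccos (D / N) \<le> arccos (- (sqrt 2 / 2)) \<longleftrightarrow> - (sqrt 2 / 2) \<le> D / N"
    by (rule arccos_le_mono[OF le1 s2])
  also have "\<dots> \<longleftrightarrow> (D < 0 \<longrightarrow> 2 * D\<^sup>2 \<le> N\<^sup>2)"
  proof (cases "D < 0")
    case True
    then have "0 \<le> sqrt 2 * (- D)" by (simp add: mult_nonneg_nonpos)
    then have "(sqrt 2 * (- D))\<^sup>2 \<le> N\<^sup>2 \<longleftrightarrow> sqrt 2 * (- D) \<le> N"
      using N by (intro power_mono_iff) auto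
    then show ?thesis using True unfolding div(1) pow by blast
  next
    case False
    then have "sqrt 2 * (- D) \<le> 0" by simp
    then show ?thesis using False N div(1) by argo
  qed
  finally show "matrix_angle A B \<le> 3 * pi / 4 \<longleftrightarrow>
      (trace_inner A B < 0 \<longrightarrow> 2 * (trace_inner A B)\<^sup>2 \<le> trace_inner A A * trace_inner B B)"
    by (simp only: angle arc N2 flip: D_def)
  have "arccos (D / N) = arccos (- (sqrt 2 / 2)) \<longleftrightarrow> - (sqrt 2 / 2) = D / N"
    using arccos_eq_iff[of "D / N" "- (sqrt 2 / 2)"] le1 s2 by auto
  also have "\<dots> \<longleftrightarrow> D < 0 \<and> 2 * D\<^sup>2 = N\<^sup>2"
  proof
    assume "- (sqrt 2 / 2) = D / N"
    then have *: "sqrt 2 * (- D) = N" using div by blast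
    then have "0 < sqrt 2 * (- D)" using N by simp
    then have "D < 0" by (simp add: mult_less_0_iff)
    then show "D < 0 \<and> 2 * D\<^sup>2 = N\<^sup>2" using * pow by simp
  next
    assume "D < 0 \<and> 2 * D\<^sup>2 = N\<^sup>2"
    then have "(sqrt 2 * (- D))\<^sup>2 = N\<^sup>2" "0 \<le> sqrt 2 * (- D)"
      unfolding pow by (auto simp: mult_nonneg_nonpos)
    then have "sqrt 2 * (- D) = N"
      by (rule power2_eq_imp_eq) (use N in simp)
    then show "- (sqrt 2 / 2) = D / N" using div by blast
  qed
  finally show "matrix_angle A B = 3 * pi / 4 \<longleftrightarrow>
      trace_inner A B < 0 \<and> 2 * (trace_inner A B)\<^sup>2 = trace_inner A A * trace_inner B B"
    by (simp only: angle arc N2 flip: D_def)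
qed

section \<open>The maximal angle and the pairs attaining it\<close>

lemma copositive_angle_le:
  fixes A B :: "real^3^3"
  assumes "A \<in> copositive" "B \<in> copositive" "A \<noteq> 0" "B \<noteq> 0"
  shows "matrix_angle A B \<le> 3 * pi / 4"
  using copositive_inner_bound[OF assms(1,2)]
    matrix_angle_bound_iff(1)[OF copositive_symmetric copositive_symmetric, OF assms]
  by blast

lemma copositive_angle_eq_iff:
  fixes A B :: "real^3^3"
  shows "A \<in> copositive \<and> B \<in> copositive \<and> A \<noteq> 0 \<and> B \<noteq> 0 \<and> matrix_angle A B = 3 * pi / 4 \<longleftrightarrow>
    (\<exists>i j k. extremal_pair A B i j k \<or> extremal_pair B A i j k)"
proof
  assume "A \<in> copositive \<and> B \<in> copositive \<and> A \<noteq> 0 \<and> B \<noteq> 0 \<and> matrix_angle A B = 3 * pi / 4"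
  then show "\<exists>i j k. extremal_pair A B i j k \<or> extremal_pair B A i j k"
    using copositive_inner_bound[of A B]
      matrix_angle_bound_iff(2)[OF copositive_symmetric copositive_symmetric, of A B]
    by blast
next
  assume "\<exists>i j k. extremal_pair A B i j k \<or> extremal_pair B A i j k"
  then obtain i j k where e: "extremal_pair A B i j k \<or> extremal_pair B A i j k" by blast
  then have cop: "A \<in> copositive" "B \<in> copositive" using extremal_pair_copositive by blast+
  have D: "trace_inner A B < 0" "2 * (trace_inner A B)\<^sup>2 = trace_inner A A * trace_inner B B"
    using e extremal_pair_inner[of A B] extremal_pair_inner[of B A]
    by (auto simp: trace_inner_commute[of B A] mult.commute)
  then have "A \<noteq> 0" "B \<noteq> 0" by (auto simp: trace_inner_sum)
  then show "A \<in> copositive \<and> B \<in> copositive \<and> A \<noteq> 0 \<and> B \<noteq> 0 \<and> matrix_angle A B = 3 * pi / 4"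
    using D cop matrix_angle_bound_iff(2)[OF copositive_symmetric copositive_symmetric, of A B]
    by blast
qed

lemma unit_copositive_angle_le:
  assumes "t \<in> unit_copositive_angles TYPE(3)"
  shows "t \<le> 3 * pi / 4"
proof -
  obtain A B :: "real^3^3" where t: "t = arccos (trace_inner A B)"
    and AB: "A \<in> copositive" "B \<in> copositive" "frobenius_norm A = 1" "frobenius_norm B = 1"
    using assms by (auto simp: unit_copositive_angles_def)
  have "t = matrix_angle A B" using AB t by (simp add: matrix_angle_def)
  moreover have "A \<noteq> 0" "B \<noteq> 0"
    using AB by (auto simp: frobenius_norm_def trace_inner_sum)
  ultimately show ?thesis using copositive_angle_le AB by simp
qed

lemma three_pi_quarters_attained: "3 * pi / 4 \<in> unit_copositive_angles TYPE(3)"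
proof -
  \<comment> \<open>The condition a22 + a33 = 1 / 2 already gives both matrices norm 1; this member
    of the family has the fewest nonzero entries.\<close>
  define A B where "A = extremal_A (1 / 2) 0" and "B = extremal_B (1 / 2) 0"
  have d: "distinct [1, 2, 3 :: 3]" by simp
  have "perm_scale_equiv (A, B) (A, B)"
    unfolding perm_scale_equiv_iff
    by (intro exI[of _ id] exI[of _ 1]) (simp add: permutes_id)
  then have "\<exists>i j k. extremal_pair A B i j k"
    unfolding A_def B_def by (intro perm_scale_extremal_imp_pair) auto
  then have AB: "A \<in> copositive" "B \<in> copositive" "matrix_angle A B = 3 * pi / 4"
    using copositive_angle_eq_iff by blast+
  have "trace_inner A A = 1"
    by (subst trace_inner_self_3[OF d copositive_symmetric[OF AB(1)]])
      (simp add: A_def extremal_A_nth real_sqrt_divide power_divide)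
  moreover have "trace_inner B B = 1"
    by (subst trace_inner_self_3[OF d copositive_symmetric[OF AB(2)]])
      (simp add: B_def extremal_B_nth)
  ultimately have "frobenius_norm A = 1" "frobenius_norm B = 1"
    by (auto simp: frobenius_norm_def)
  moreover from this have "3 * pi / 4 = arccos (trace_inner A B)"
    using AB(3) by (simp add: matrix_angle_def)
  ultimately show ?thesis
    using AB(1,2) unfolding unit_copositive_angles_def by blast
qed

theorem theorem3p1:
  shows "(\<forall>A B :: real^3^3. A \<in> copositive \<and> B \<in> copositive \<and> A \<noteq> 0 \<and> B \<noteq> 0
             \<longrightarrow> matrix_angle A B \<le> 3 * pi / 4)
       \<and> 3 * pi / 4 \<in> unit_copositive_angles TYPE(3)
       \<and> max_copositive_angle TYPE(3) = 3 * pi / 4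
       \<and> (\<forall>A B :: real^3^3.
             (A \<in> copositive \<and> B \<in> copositive \<and> A \<noteq> 0 \<and> B \<noteq> 0
                \<and> matrix_angle A B = 3 * pi / 4)
             \<longleftrightarrow> (\<exists>a22 a33. a22 \<ge> 0 \<and> a33 \<ge> 0 \<and> a22 + a33 = 1/2
                   \<and> (perm_scale_equiv (extremal_A a22 a33, extremal_B a22 a33) (A, B)
                      \<or> perm_scale_equiv (extremal_A a22 a33, extremal_B a22 a33) (B, A))))"
proof (intro conjI allI)
  fix A B :: "real^3^3"
  show "A \<in> copositive \<and> B \<in> copositive \<and> A \<noteq> 0 \<and> B \<noteq> 0 \<longrightarrow> matrix_angle A B \<le> 3 * pi / 4"
    using copositive_angle_le by blast
  show "3 * pi / 4 \<in> unit_copositive_angles TYPE(3)"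
    by (rule three_pi_quarters_attained)
  show "max_copositive_angle TYPE(3) = 3 * pi / 4"
    unfolding max_copositive_angle_def
    by (intro Greatest_equality three_pi_quarters_attained unit_copositive_angle_le)
  show "(A \<in> copositive \<and> B \<in> copositive \<and> A \<noteq> 0 \<and> B \<noteq> 0 \<and> matrix_angle A B = 3 * pi / 4)
      \<longleftrightarrow> (\<exists>a22 a33. a22 \<ge> 0 \<and> a33 \<ge> 0 \<and> a22 + a33 = 1/2
        \<and> (perm_scale_equiv (extremal_A a22 a33, extremal_B a22 a33) (A, B)
          \<or> perm_scale_equiv (extremal_A a22 a33, extremal_B a22 a33) (B, A)))"
    unfolding copositive_angle_eq_iff
    using perm_scale_extremal_imp_pair extremal_pair_imp_perm_scale by metis
qed

end
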